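(* Let $n\ge 2$, let $w$ be a weight on $\mathbb{R}^n$ and let $a:\mathcal{Q}\to(0,\infty)$ be a functional on cubes satisfying: (1) for some $p\ge1$: for any cube $Q$ and any family $\{Q_i\}$ of pairwise disjoint subcubes of $Q$ such that $\sum_i|Q_i|\le|Q|/L$ with $L>1$, $$\sum_i a(Q_i)^p w(Q_i)\le\left(\frac1L\right)^{p/n}a(Q)^p w(Q);$$ (2) for some $r>p$: there is a constant $\|a\|_{D_r(w)}$ such that for any cube $Q$ and any family $\Lambda$ of pairwise disjoint subcubes of $Q$, $$\sum_{P\in\Lambda}a(P)^r w(P)\le\|a\|_{D_r(w)}^r\,a(Q)^r w(Q).$$ Let $f$ be a locally integrable function such that $$\frac{1}{|Q|}\int_Q|f-f_Q|\,dx\le a(Q)$$ for every cube $Q$. Let $w\in A_p$. Then there exists a constant $c$ such that for any cube $Q$ $$\|f-f_Q\|_{L^{r,\infty}(Q,\frac{w\,dx}{w(Q)})}\le c\,\|a\|_{D_r(w)}\,[w]_{A_p}^{1/p}\,a(Q).$$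
   Context: Cubes are cubes in $\mathbb{R}^n$ with sides parallel to the coordinate axes; $\mathcal{Q}$ is the family of all cubes. A weight is a locally integrable non-negative function; $w(E)=\int_E w\,dx$; $f_Q=\frac{1}{|Q|}\int_Q f\,dx$. For $1<p<\infty$, $$[w]_{A_p}:=\sup_Q\left(\frac{1}{|Q|}\int_Q w\right)\left(\frac{1}{|Q|}\int_Q w^{1-p'}\right)^{p-1},\quad p'=\frac{p}{p-1},\qquad [w]_{A_1}:=\sup_Q\left(\frac{1}{|Q|}\int_Q w\right)\operatorname*{ess\,sup}_Q(w^{-1}),$$ and $w\in A_p$ means $[w]_{A_p}<\infty$. The normalized weak norm is $$\|g\|_{L^{r,\infty}(Q,\frac{w\,dx}{w(Q)})}:=\sup_{\lambda>0}\lambda\left(\frac{w(\{x\in Q:|g(x)|>\lambda\})}{w(Q)}\right)^{1/r}.$$ *)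

theory Defs
  imports "HOL-Analysis.Analysis" "HOL-Probability.Essential_Supremum"
begin

text \<open>Cubes are taken half-open, so that cubes tiling a larger cube are pairwise disjoint as
  sets. Up to null sets this is the same as working with closed cubes that are allowed to share
  boundary points.\<close>

definition cubes :: "(real ^ 'n) set set" where
  "cubes = {Q. \<exists>c l. l > 0 \<and> Q = {x. \<forall>i. c $ i \<le> x $ i \<and> x $ i < c $ i + l}}"

definition subcube_family :: "(real ^ 'n) set \<Rightarrow> (real ^ 'n) set set \<Rightarrow> bool" where
  "subcube_family Q \<Lambda> \<longleftrightarrow> \<Lambda> \<subseteq> cubes \<and> (\<forall>P\<in>\<Lambda>. P \<subseteq> Q) \<and> disjoint \<Lambda>"

definition locally_integrable :: "(real ^ 'n \<Rightarrow> real) \<Rightarrow> bool" where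
  "locally_integrable f \<longleftrightarrow> (\<forall>K. compact K \<longrightarrow> f absolutely_integrable_on K)"

definition weight :: "(real ^ 'n \<Rightarrow> real) \<Rightarrow> bool" where
  "weight w \<longleftrightarrow> locally_integrable w \<and> (\<forall>x. w x \<ge> 0)"

definition wmeas :: "(real ^ 'n \<Rightarrow> real) \<Rightarrow> (real ^ 'n) set \<Rightarrow> real" where
  "wmeas w E = (LINT x:E|lebesgue. w x)"

definition avg :: "(real ^ 'n) set \<Rightarrow> (real ^ 'n \<Rightarrow> real) \<Rightarrow> real" where
  "avg Q f = (LINT x:Q|lebesgue. f x) / measure lebesgue Q"

definition eavg :: "(real ^ 'n) set \<Rightarrow> (real ^ 'n \<Rightarrow> ennreal) \<Rightarrow> ennreal" where
  "eavg Q g = (\<integral>\<^sup>+x\<in>Q. g x \<partial>lebesgue) / emeasure lebesgue Q"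

text \<open>Real powers of extended non-negative reals. In particular a negative power of \<open>0\<close> is
  \<open>\<infinity>\<close>, unlike for \<open>powr\<close> on the reals; this matters where a weight vanishes.\<close>

definition epowr :: "ennreal \<Rightarrow> real \<Rightarrow> ennreal" where
  "epowr x s =
    (if s = 0 then 1
     else if x = 0 then (if s > 0 then 0 else \<infinity>)
     else if x = \<infinity> then (if s > 0 then \<infinity> else 0)
     else ennreal (enn2real x powr s))"

text \<open>Only \<open>p \<ge> 1\<close> is meaningful. The products are taken in \<^typ>\<open>ennreal\<close>, where
  \<open>0 * \<infinity> = 0\<close> and \<open>inverse 0 = \<infinity>\<close>. Hence a weight that vanishes on a set of positive measure
  has infinite constant, unless it vanishes almost everywhere.\<close>

definition Ap_const :: "real \<Rightarrow> (real ^ 'n \<Rightarrow> real) \<Rightarrow> ennreal" where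
  "Ap_const p w =
    (if p = 1 then
       (SUP Q\<in>cubes. eavg Q (\<lambda>x. ennreal (w x)) *
          esssup (restrict_space lebesgue Q) (\<lambda>x. inverse (ennreal (w x))))
     else
       (SUP Q\<in>cubes. eavg Q (\<lambda>x. ennreal (w x)) *
          epowr (eavg Q (\<lambda>x. epowr (ennreal (w x)) (1 - p / (p - 1)))) (p - 1)))"

definition in_Ap :: "real \<Rightarrow> (real ^ 'n \<Rightarrow> real) \<Rightarrow> bool" where
  "in_Ap p w \<longleftrightarrow> Ap_const p w < \<infinity>"

definition weak_norm ::
    "real \<Rightarrow> (real ^ 'n \<Rightarrow> real) \<Rightarrow> (real ^ 'n) set \<Rightarrow> (real ^ 'n \<Rightarrow> real) \<Rightarrow> ennreal" where
  "weak_norm r w Q g =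
    (SUP t\<in>{0<..}. ennreal (t * (wmeas w {x\<in>Q. \<bar>g x\<bar> > t} / wmeas w Q) powr (1 / r)))"

text \<open>Sums over (possibly infinite) families of cubes are formed in \<^typ>\<open>ennreal\<close>, where they
  always converge; a real-valued \<open>infsum\<close> would be \<open>0\<close> for a divergent family.\<close>

definition small_condition ::
    "real \<Rightarrow> (real ^ 'n \<Rightarrow> real) \<Rightarrow> ((real ^ 'n) set \<Rightarrow> real) \<Rightarrow> bool" where
  "small_condition p w a \<longleftrightarrow>
    (\<forall>Q\<in>cubes. \<forall>\<Lambda>. \<forall>L>1. subcube_family Q \<Lambda> \<longrightarrow>
      (\<Sum>\<^sub>\<infinity>P\<in>\<Lambda>. emeasure lebesgue P) \<le> ennreal (measure lebesgue Q / L) \<longrightarrow>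
      (\<Sum>\<^sub>\<infinity>P\<in>\<Lambda>. ennreal (a P powr p * wmeas w P))
        \<le> ennreal ((1 / L) powr (p / real CARD('n)) * a Q powr p * wmeas w Q))"

definition D_condition ::
    "real \<Rightarrow> (real ^ 'n \<Rightarrow> real) \<Rightarrow> ((real ^ 'n) set \<Rightarrow> real) \<Rightarrow> real \<Rightarrow> bool" where
  "D_condition r w a A \<longleftrightarrow> A \<ge> 0 \<and>
    (\<forall>Q\<in>cubes. \<forall>\<Lambda>. subcube_family Q \<Lambda> \<longrightarrow>
      (\<Sum>\<^sub>\<infinity>P\<in>\<Lambda>. ennreal (a P powr r * wmeas w P))
        \<le> ennreal (A powr r * a Q powr r * wmeas w Q))"

end

theory Submission
  imports Defs
begin

text \<open>Iterating Calderon--Zygmund decompositions of \<open>\<bar>f - f\<^sub>Q\<bar>\<close> at heights proportional to \<open>a(Q)\<close>, the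
  smallness condition turns the resulting error terms into a geometric series, which gives
  \<open>\<integral>\<^sub>Q \<bar>f - f\<^sub>Q\<bar>\<^sup>p w \<le> C a(Q)\<^sup>p w(Q)\<close> with \<open>C = C(n, p)\<close> for any weight \<open>w\<close>. The weak \<open>L\<^sup>r\<close> bound
  follows from a good-\<open>\<lambda>\<close> argument: let \<open>\<Omega>\<^sub>t\<close> be the union of the maximal dyadic subcubes \<open>P\<close> of \<open>Q\<close> on
  which \<open>\<bar>f - f\<^sub>Q\<bar>\<close> has average above \<open>t\<close>, and let \<open>M = 2\<^sup>n + 1\<close>. If \<open>a(P) \<le> \<gamma> t\<close>, the \<open>L\<^sup>p\<close> bound
  on \<open>P\<close> and the \<open>A\<^sub>p\<close> condition give \<open>w(P \<inter> \<Omega>\<^bsub>M t\<^esub>) \<le> C' [w] \<gamma>\<^sup>p w(P)\<close>, and the cubes with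
  \<open>a(P) > \<gamma> t\<close> are controlled by the condition \<open>D\<^sub>r\<close>. Choosing \<open>\<gamma>\<close> proportional to \<open>[w]\<^bsup>-1/p\<^esup>\<close> makes
  the first term absorbable and produces exactly the factor \<open>[w]\<^bsup>1/p\<^esup>\<close>.\<close>

subsection \<open>Dyadic cubes\<close>

text \<open>No integrability of |f - f_Q|^p against w is known in advance, so an inequality X \<le>
  B + 2^(-p) X cannot be solved by subtraction. Instead, an induction on the number m of
  Calderon--Zygmund steps bounds the integral off a set of Lebesgue measure at most 4^(-nm) |Q|,
  with a constant independent of m; Borel--Cantelli and Fatou then remove the exceptional sets. The
  height 4^n makes the smallness condition gain 4^(-p), which beats the factor 2^p lost in the
  triangle inequality. In the good-lambda step, averages are taken with respect to dx but sets are
  measured by w; the A_p condition translates between the two. The value of M has this origin: the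
  parent of a stopping cube P has average at most t, so |f_P - f_Q| \<le> 2^n t, and on cubes with
  average above (2^n + 1) t an excess t remains for |f - f_P|. Absorption is again an induction,
  along the levels M^k a(Q); its start at a(Q) rests on lower bounds for [w] and for the constant of
  the D_r condition. All constants depend on n, p, r only.\<close>

definition cube :: "real ^ 'n \<Rightarrow> real \<Rightarrow> (real ^ 'n) set" where
  "cube c l = {x. \<forall>i. c $ i \<le> x $ i \<and> x $ i < c $ i + l}"

lemma cubesE:
  assumes "Q \<in> cubes"
  obtains c l where "l > 0" "Q = cube c l"
  using assms by (auto simp: cubes_def cube_def)

lemma cube_in_cubes: "l > 0 \<Longrightarrow> cube c l \<in> cubes"
  by (auto simp: cubes_def cube_def)

lemma cube_between: "box c (c + l *\<^sub>R One) \<subseteq> cube c l" "cube c l \<subseteq> cbox c (c + l *\<^sub>R One)"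
proof -
  have *: "(c + l *\<^sub>R One) $ i = c $ i + l" for i
    by (simp add: cart_eq_inner_axis inner_simps inner_sum_left_Basis)
  then show "box c (c + l *\<^sub>R One) \<subseteq> cube c l" "cube c l \<subseteq> cbox c (c + l *\<^sub>R One)"
    unfolding subset_iff cube_def mem_Collect_eq mem_box_cart * by (auto intro: less_imp_le)
qed

lemma cube_borel [measurable]: "cube (c :: real ^ 'n) l \<in> sets borel"
proof -
  have "cube c l = (\<Inter>i. {x. c $ i \<le> x $ i} \<inter> {x. x $ i < c $ i + l})"
    by (auto simp: cube_def)
  also have "\<dots> \<in> sets borel"
    by measurable
  finally show ?thesis .
qed

lemma emeasure_cube:
  assumes "l \<ge> 0"
  shows "emeasure lebesgue (cube (c :: real ^ 'n) l) = ennreal (l ^ CARD('n))"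
proof -
  let ?d = "c + l *\<^sub>R One"
  have *: "(\<Prod>b\<in>Basis. (?d - c) \<bullet> b) = l ^ CARD('n)"
    by simp
  have le: "\<And>b. b \<in> Basis \<Longrightarrow> c \<bullet> b \<le> ?d \<bullet> b"
    using assms by (simp add: inner_simps)
  have "emeasure lborel (box c ?d) = ennreal (l ^ CARD('n))"
    "emeasure lborel (cbox c ?d) = ennreal (l ^ CARD('n))"
    using emeasure_lborel_box[OF le] emeasure_lborel_cbox[OF le] * by simp_all
  moreover have "emeasure lborel (box c ?d) \<le> emeasure lborel (cube c l)"
    "emeasure lborel (cube c l) \<le> emeasure lborel (cbox c ?d)"
    using cube_between[of c l] by (auto intro!: emeasure_mono)
  ultimately show ?thesis by (auto intro: antisym)
qed

text \<open>The cell of generation \<open>k\<close> containing \<open>x\<close>, in the dyadic grid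
  generated by \<open>cube c l\<close>. Indexing cells by their points instead of integer vectors
  makes being in the same cell an equality of floors, and turns the cells through a fixed point into
  a decreasing sequence in \<open>k\<close>.\<close>

definition dyad :: "real ^ 'n \<Rightarrow> real \<Rightarrow> nat \<Rightarrow> real ^ 'n \<Rightarrow> (real ^ 'n) set" where
  "dyad c l k x = {y. \<forall>i. \<lfloor>(y $ i - c $ i) * 2 ^ k / l\<rfloor> = \<lfloor>(x $ i - c $ i) * 2 ^ k / l\<rfloor>}"

lemma dyad_self [simp]: "x \<in> dyad c l k x"
  by (simp add: dyad_def)

lemma dyad_eq: "y \<in> dyad c l k x \<Longrightarrow> dyad c l k y = dyad c l k x"
  by (simp add: dyad_def)

lemma dyad_eq_cube:
  assumes "l > 0"
  shows "dyad c l k x = cube (\<chi> i. c $ i + \<lfloor>(x $ i - c $ i) * 2 ^ k / l\<rfloor> * (l / 2 ^ k)) (l / 2 ^ k)"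
proof -
  have "\<lfloor>(u - v) * 2 ^ k / l\<rfloor> = m \<longleftrightarrow> v + m * (l / 2 ^ k) \<le> u \<and> u < v + m * (l / 2 ^ k) + l / 2 ^ k"
    for u v :: real and m :: int
    unfolding floor_eq_iff using assms by (simp add: field_simps)
  then show ?thesis unfolding dyad_def cube_def by (simp add: set_eq_iff)
qed

lemma dyad_0:
  assumes "l > 0" "x \<in> cube c l"
  shows "dyad c l 0 x = cube c l"
proof -
  have "\<lfloor>(x $ i - c $ i) / l\<rfloor> = 0" for i
    using assms unfolding floor_eq_iff cube_def by (auto simp: field_simps)
  then show ?thesis using assms by (simp add: dyad_eq_cube)
qed

lemma dyad_Suc: "dyad c l (Suc k) x \<subseteq> dyad c l k x"
proof
  fix y assume "y \<in> dyad c l (Suc k) x"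
  moreover have "\<lfloor>u * 2 ^ k / l\<rfloor> = \<lfloor>u * 2 ^ Suc k / l\<rfloor> div 2" for u
  proof -
    have "\<lfloor>(u * 2 ^ Suc k / l) / of_int 2\<rfloor> = \<lfloor>u * 2 ^ Suc k / l\<rfloor> div 2"
      by (rule floor_divide_real_eq_div) simp
    then show ?thesis by simp
  qed
  ultimately show "y \<in> dyad c l k x" by (simp add: dyad_def)
qed

lemma dyad_mono: "j \<le> k \<Longrightarrow> dyad c l k x \<subseteq> dyad c l j x"
  using lift_Suc_antimono_le[of "\<lambda>k. dyad c l k x"] dyad_Suc by blast

lemma dyad_subset_cube: "l > 0 \<Longrightarrow> x \<in> cube c l \<Longrightarrow> dyad c l k x \<subseteq> cube c l"
  using dyad_0[of l x c] dyad_mono[of 0 k c l x] by simp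

lemma dyad_in_cubes: "l > 0 \<Longrightarrow> dyad c l k x \<in> cubes"
  by (simp add: dyad_eq_cube cube_in_cubes)

lemma emeasure_dyad: "l > 0 \<Longrightarrow> emeasure lebesgue (dyad (c :: real ^ 'n) l k x) = ennreal ((l / 2 ^ k) ^ CARD('n))"
  unfolding dyad_eq_cube by (rule emeasure_cube) simp

lemma emeasure_dyad_Suc:
  assumes "l > 0"
  shows "emeasure lebesgue (dyad (c :: real ^ 'n) l k x) = 2 ^ CARD('n) * emeasure lebesgue (dyad c l (Suc k) x)"
proof -
  have "2 ^ CARD('n) * ennreal ((l / 2 ^ Suc k) ^ CARD('n)) = ennreal (2 ^ CARD('n) * (l / 2 ^ Suc k) ^ CARD('n))"
    using assms by (simp add: ennreal_mult ennreal_power[symmetric])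
  also have "2 ^ CARD('n) * (l / 2 ^ Suc k) ^ CARD('n) = (l / 2 ^ k) ^ CARD('n)"
    by (simp flip: power_mult_distrib)
  finally show ?thesis using assms by (simp only: emeasure_dyad)
qed

lemma dyad_subset_open:
  assumes "l > 0" "open U" "x \<in> U"
  shows "\<exists>k. dyad (c :: real ^ 'n) l k x \<subseteq> U"
proof -
  obtain e where e: "e > 0" "ball x e \<subseteq> U"
    using assms open_contains_ball by blast
  have "(\<lambda>k. real CARD('n) * (l / 2 ^ k)) \<longlonglongrightarrow> 0"
    by (rule tendsto_mult_right_zero, rule LIMSEQ_divide_realpow_zero) simp
  then obtain k where k: "real CARD('n) * (l / 2 ^ k) < e"
    using e by (metis order_tendstoD(2) eventually_sequentially order_refl)
  have "dyad c l k x \<subseteq> ball x e"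
  proof
    fix y assume y: "y \<in> dyad c l k x"
    have "\<bar>(y - x) $ i\<bar> \<le> l / 2 ^ k" for i
    proof -
      obtain d where d: "dyad c l k x = cube d (l / 2 ^ k)"
        using dyad_eq_cube[OF assms(1)] by blast
      have "x \<in> cube d (l / 2 ^ k)" "y \<in> cube d (l / 2 ^ k)" using y d dyad_self by blast+
      then have "d $ i \<le> x $ i" "x $ i < d $ i + l / 2 ^ k" "d $ i \<le> y $ i" "y $ i < d $ i + l / 2 ^ k"
        by (auto simp: cube_def)
      then show ?thesis by simp
    qed
    then have "norm (y - x) \<le> (\<Sum>i\<in>(UNIV::'n set). l / 2 ^ k)"
      by (intro order_trans[OF norm_le_l1_cart] sum_mono) auto
    then show "y \<in> ball x e" using k by (simp add: dist_norm norm_minus_commute)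
  qed
  with e show ?thesis by blast
qed

text \<open>A cell is determined by its generation and an integer vector, and there are only
  countably many such pairs.\<close>

lemma countable_dyads: "countable {dyad (c :: real ^ 'n) l k x |k x. True}"
proof (rule countable_subset)
  show "{dyad c l k x |k x. True} \<subseteq>
    range (\<lambda>(k, m). {y. \<forall>i. \<lfloor>(y $ i - c $ i) * 2 ^ k / l\<rfloor> = (m :: 'n \<Rightarrow> int) i})"
  proof safe
    fix k x
    show "dyad c l k x \<in> range (\<lambda>(k, m). {y. \<forall>i. \<lfloor>(y $ i - c $ i) * 2 ^ k / l\<rfloor> = (m :: 'n \<Rightarrow> int) i})"
      by (rule image_eqI[of _ _ "(k, \<lambda>i. \<lfloor>(x $ i - c $ i) * 2 ^ k / l\<rfloor>)"]) (auto simp: dyad_def)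
  qed
qed simp

text \<open>The maximal dyadic subcubes with property \<open>P\<close>: going down the cells through
  \<open>x\<close> from the whole cube, the first one that satisfies \<open>P\<close> is selected.
  The whole cube itself may be selected, at \<open>k = 0\<close>.\<close>

definition stop :: "real ^ 'n \<Rightarrow> real \<Rightarrow> ((real ^ 'n) set \<Rightarrow> bool) \<Rightarrow> (real ^ 'n) set set" where
  "stop c l P = {dyad c l k x |k x. x \<in> cube c l \<and> P (dyad c l k x) \<and> (\<forall>j<k. \<not> P (dyad c l j x))}"

text \<open>All points of a cell have the same ancestors, so any point of a selected cube can serve
  as the point in its definition. Disjointness and nesting thereby reduce to comparing generations
  at a common point.\<close>

lemma stop_cases:
  assumes "R \<in> stop c l P" "y \<in> R"
  obtains k where "R = dyad c l k y" "P R" "\<And>j. j < k \<Longrightarrow> \<not> P (dyad c l j y)"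
proof -
  obtain k x where *: "R = dyad c l k x" "P R" "\<And>j. j < k \<Longrightarrow> \<not> P (dyad c l j x)"
    using assms unfolding stop_def by blast
  have "dyad c l j y = dyad c l j x" if "j \<le> k" for j
    using assms * dyad_mono[OF that, of c l x] by (intro dyad_eq) auto
  with * that show ?thesis by (metis less_imp_le order_refl)
qed

lemma stop_P: "R \<in> stop c l P \<Longrightarrow> P R"
  by (auto simp: stop_def)

lemma stop_subset: "l > 0 \<Longrightarrow> R \<in> stop c l P \<Longrightarrow> R \<subseteq> cube c l"
  unfolding stop_def using dyad_subset_cube by blast

lemma stop_disjoint: "disjoint (stop c l P)"
proof (rule disjointI)
  fix R S assume RS: "R \<in> stop c l P" "S \<in> stop c l P" "R \<noteq> S"
  show "R \<inter> S = {}"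
  proof (rule ccontr)
    assume "R \<inter> S \<noteq> {}"
    then obtain y where y: "y \<in> R" "y \<in> S" by blast
    obtain k where k: "R = dyad c l k y" "P R" "\<And>j. j < k \<Longrightarrow> \<not> P (dyad c l j y)"
      using stop_cases[OF RS(1) y(1)] by blast
    obtain m where m: "S = dyad c l m y" "P S" "\<And>j. j < m \<Longrightarrow> \<not> P (dyad c l j y)"
      using stop_cases[OF RS(2) y(2)] by blast
    show False using k m RS(3) by (metis linorder_neqE_nat)
  qed
qed

lemma stop_family: "l > 0 \<Longrightarrow> subcube_family (cube c l) (stop c l P)"
  unfolding subcube_family_def
  using stop_disjoint[of c l P] stop_subset[of l _ c P] dyad_in_cubes[of l c]
  by (auto simp: stop_def)

lemma countable_stop: "countable (stop c l P)"
  by (rule countable_subset[OF _ countable_dyads[of c l]]) (auto simp: stop_def)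

lemma stop_cover:
  assumes "x \<in> cube c l" "P (dyad c l k x)"
  obtains R where "R \<in> stop c l P" "dyad c l k x \<subseteq> R"
proof
  let ?j = "LEAST j. P (dyad c l j x)"
  have j: "P (dyad c l ?j x)" "?j \<le> k" "\<And>i. i < ?j \<Longrightarrow> \<not> P (dyad c l i x)"
    using assms by (auto intro: LeastI Least_le dest: not_less_Least)
  then show "dyad c l ?j x \<in> stop c l P" using assms unfolding stop_def by blast
  show "dyad c l k x \<subseteq> dyad c l ?j x" using j(2) by (rule dyad_mono)
qed

text \<open>Rejecting the whole cube forces generation at least 1, so a parent exists inside the
  cube, and minimality of the generation means that the parent was rejected. This is the source of
  the factor 2^n in upper bounds for averages.\<close>

lemma stop_parent:
  fixes c :: "real ^ 'n"
  assumes "l > 0" "R \<in> stop c l P" "\<not> P (cube c l)"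
  obtains S where "S \<in> cubes" "R \<subseteq> S" "S \<subseteq> cube c l" "\<not> P S"
    "emeasure lebesgue S = 2 ^ CARD('n) * emeasure lebesgue R"
proof -
  obtain k x where *: "R = dyad c l k x" "P R" "\<And>j. j < k \<Longrightarrow> \<not> P (dyad c l j x)" "x \<in> cube c l"
    using assms unfolding stop_def by blast
  have "k \<noteq> 0" using * assms dyad_0[of l x c] by metis
  then obtain j where j: "k = Suc j" by (cases k) auto
  show ?thesis
  proof (rule that)
    show "dyad c l j x \<in> cubes" using assms by (simp add: dyad_in_cubes)
    show "R \<subseteq> dyad c l j x" using * j dyad_Suc by simp
    show "dyad c l j x \<subseteq> cube c l" using * assms by (simp add: dyad_subset_cube)
    show "\<not> P (dyad c l j x)" using * j by simp
    show "emeasure lebesgue (dyad c l j x) = 2 ^ CARD('n) * emeasure lebesgue R"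
      unfolding * j by (rule emeasure_dyad_Suc) fact
  qed
qed

text \<open>Through a common point, a stronger property cannot be met at an earlier generation than
  a weaker one.\<close>

lemma stop_nested:
  assumes "\<And>S. P' S \<Longrightarrow> P S" "R' \<in> stop c l P'" "R \<in> stop c l P" "R \<inter> R' \<noteq> {}"
  shows "R' \<subseteq> R"
proof -
  obtain y where y: "y \<in> R" "y \<in> R'" using assms by blast
  obtain m where m: "R' = dyad c l m y" "P' R'" using stop_cases[OF assms(2) y(2)] by blast
  obtain k where k: "R = dyad c l k y" "\<And>j. j < k \<Longrightarrow> \<not> P (dyad c l j y)"
    using stop_cases[OF assms(3) y(1)] by blast
  have "k \<le> m" using k(2) m assms(1) by (metis linorder_not_less)
  then show ?thesis using k(1) m(1) dyad_mono by blast
qed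

lemma stop_Union_mono:
  assumes "\<And>S. P' S \<Longrightarrow> P S"
  shows "\<Union>(stop c l P') \<subseteq> \<Union>(stop c l P)"
proof
  fix y assume "y \<in> \<Union>(stop c l P')"
  then obtain k x where x: "x \<in> cube c l" "P' (dyad c l k x)" "y \<in> dyad c l k x"
    unfolding stop_def by blast
  obtain R where "R \<in> stop c l P" "dyad c l k x \<subseteq> R"
    using stop_cover[of x c l P k] x(1) assms[OF x(2)] by blast
  with x show "y \<in> \<Union>(stop c l P)" by blast
qed

subsection \<open>Calderon--Zygmund cubes\<close>

text \<open>A bridge between two kinds of sums: the hypotheses on \<open>a\<close> are stated with
  \<open>infsum\<close>, while the estimates use integrals over counting measures, for which
  monotonicity, linearity and countable additivity are at hand.\<close>

lemma nn_integral_count_space_eq_infsum: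
  fixes f :: "'a \<Rightarrow> ennreal"
  assumes "countable A"
  shows "(\<integral>\<^sup>+x. f x \<partial>count_space A) = infsum f A"
proof (cases "finite A")
  case True
  then show ?thesis by (simp add: nn_integral_count_space_finite)
next
  case False
  let ?g = "from_nat_into A"
  have bij: "bij_betw ?g UNIV A"
    using assms False by (rule bij_betw_from_nat_into)
  have inj: "inj_on ?g X" for X
    using bij by (auto simp: bij_betw_def intro: inj_on_subset)
  have "(\<integral>\<^sup>+x. f x \<partial>count_space A) = (\<integral>\<^sup>+i. f (?g i) \<partial>count_space UNIV)"
    using nn_integral_bij_count_space[OF bij, of f] by simp
  also have "\<dots> = (\<Sum>i. f (?g i))"
    by (rule nn_integral_count_space_nat)
  also have "\<dots> = (SUP n. \<Sum>i<n. f (?g i))"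
    by (rule suminf_eq_SUP)
  also have "\<dots> \<le> infsum f A"
  proof (rule SUP_least)
    fix n
    have "(\<Sum>i<n. f (?g i)) = sum f (?g ` {..<n})"
      using sum.reindex[OF inj[of "{..<n}"], of f] by (simp add: o_def)
    also have "\<dots> \<le> infsum f A"
      unfolding nonneg_infsum_complete[OF zero_le]
      using bij by (intro SUP_upper) (auto simp: bij_betw_def)
    finally show "(\<Sum>i<n. f (?g i)) \<le> infsum f A" .
  qed
  finally have "(\<integral>\<^sup>+x. f x \<partial>count_space A) \<le> infsum f A" .
  moreover have "infsum f A \<le> (\<integral>\<^sup>+x. f x \<partial>count_space A)"
    unfolding nonneg_infsum_complete[OF zero_le]
  proof (rule SUP_least)
    fix F assume "F \<in> {F. finite F \<and> F \<subseteq> A}"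
    then have F: "finite F" "F \<subseteq> A" by auto
    have "sum f F = (\<integral>\<^sup>+x. f x * indicator F x \<partial>count_space A)"
      by (subst nn_integral_restrict_space[symmetric])
         (use F in \<open>auto simp: restrict_count_space Int_absorb1 Int_absorb2 nn_integral_count_space_finite\<close>)
    also have "\<dots> \<le> (\<integral>\<^sup>+x. f x \<partial>count_space A)"
      by (intro nn_integral_mono) (auto split: split_indicator)
    finally show "sum f F \<le> (\<integral>\<^sup>+x. f x \<partial>count_space A)" .
  qed
  ultimately show ?thesis by (rule antisym)
qed

lemma emeasure_Union_disjoint:
  assumes "countable F" "F \<subseteq> sets M" "disjoint F"
  shows "emeasure M (\<Union>F) = (\<integral>\<^sup>+R. emeasure M R \<partial>count_space F)"
  using emeasure_UN_countable[of F "\<lambda>R. R" M] assms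
  by (auto simp: disjoint_family_on_def disjoint_def subset_iff)

lemma set_nn_integral_UN_disjoint:
  assumes "countable I" "\<And>i. i \<in> I \<Longrightarrow> X i \<in> sets M" "disjoint_family_on X I"
    and h [measurable]: "h \<in> borel_measurable M"
  shows "(\<integral>\<^sup>+x\<in>(\<Union>i\<in>I. X i). h x \<partial>M) = (\<integral>\<^sup>+i. (\<integral>\<^sup>+x\<in>X i. h x \<partial>M) \<partial>count_space I)"
proof -
  have "(\<Union>i\<in>I. X i) \<in> sets M" using assms by (intro sets.countable_UN') auto
  then have "(\<integral>\<^sup>+x\<in>(\<Union>i\<in>I. X i). h x \<partial>M) = emeasure (density M h) (\<Union>i\<in>I. X i)"
    using h by (simp add: emeasure_density)
  also have "\<dots> = (\<integral>\<^sup>+i. emeasure (density M h) (X i) \<partial>count_space I)"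
    using assms by (intro emeasure_UN_countable) auto
  also have "\<dots> = (\<integral>\<^sup>+i. (\<integral>\<^sup>+x\<in>X i. h x \<partial>M) \<partial>count_space I)"
    using assms by (intro nn_integral_cong) (auto simp: emeasure_density)
  finally show ?thesis .
qed

lemma set_nn_integral_Union_disjoint:
  assumes "countable F" "F \<subseteq> sets M" "disjoint F" "h \<in> borel_measurable M"
  shows "(\<integral>\<^sup>+x\<in>\<Union>F. h x \<partial>M) = (\<integral>\<^sup>+R. (\<integral>\<^sup>+x\<in>R. h x \<partial>M) \<partial>count_space F)"
  using set_nn_integral_UN_disjoint[of F "\<lambda>R. R" M h] assms
  by (auto simp: disjoint_family_on_def disjoint_def subset_iff)

lemma cubes_lebesgue: "(Q :: (real ^ 'n) set) \<in> cubes \<Longrightarrow> Q \<in> sets lebesgue"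
  by (erule cubesE) (simp add: cube_borel)

lemma cubes_emeasure:
  assumes "(Q :: (real ^ 'n) set) \<in> cubes"
  shows "emeasure lebesgue Q = ennreal (measure lebesgue Q)" "measure lebesgue Q > 0"
    "0 < emeasure lebesgue Q" "emeasure lebesgue Q < \<infinity>"
proof -
  obtain c l where *: "l > 0" "Q = cube c l" using assms by (rule cubesE)
  have e: "emeasure lebesgue Q = ennreal (l ^ CARD('n))"
    unfolding *(2) by (rule emeasure_cube) (use * in simp)
  then have m: "measure lebesgue Q = l ^ CARD('n)" using * by (simp add: measure_def)
  show "emeasure lebesgue Q = ennreal (measure lebesgue Q)" "measure lebesgue Q > 0"
    "0 < emeasure lebesgue Q" "emeasure lebesgue Q < \<infinity>"
    unfolding m unfolding e using * by simp_all
qed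

text \<open>Outer regularity takes the place of the Lebesgue differentiation theorem: an open neighbourhood
  \<open>U\<close> of the exceptional set \<open>E\<close> is covered near \<open>E\<close> by disjoint dyadic cubes that lie in \<open>U\<close> and
  meet \<open>E\<close>, and on each of them the average of \<open>h\<close> is at most \<open>s\<close>.\<close>

lemma AE_le_outside_stop:
  fixes c :: "real ^ 'n" and h :: "real ^ 'n \<Rightarrow> ennreal"
  assumes l: "l > 0" and h [measurable]: "h \<in> borel_measurable lebesgue" and s: "s \<ge> 0"
  defines "F \<equiv> stop c l (\<lambda>R. ennreal s * emeasure lebesgue R < (\<integral>\<^sup>+x\<in>R. h x \<partial>lebesgue))"
  shows "AE x in lebesgue. x \<in> cube c l - \<Union>F \<longrightarrow> h x \<le> ennreal s"
proof -
  have sets_stop: "stop c l P \<subseteq> sets lebesgue" for P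
    using stop_family[OF l, of c P] cubes_lebesgue by (auto simp: subcube_family_def)
  define G where "G = cube c l - \<Union>F"
  have [measurable]: "G \<in> sets lebesgue"
    unfolding G_def F_def using sets_stop cube_borel
    by (intro sets.Diff sets.countable_Union countable_stop) auto
  have avg: "(\<integral>\<^sup>+x\<in>dyad c l k x. h x \<partial>lebesgue) \<le> ennreal s * emeasure lebesgue (dyad c l k x)"
    if x: "x \<in> G" for k x
  proof (rule ccontr)
    assume "\<not> ?thesis"
    then have *: "ennreal s * emeasure lebesgue (dyad c l k x) < (\<integral>\<^sup>+x\<in>dyad c l k x. h x \<partial>lebesgue)"
      by (simp only: not_le)
    have "x \<in> cube c l" using x by (simp add: G_def)
    from stop_cover[of x c l "\<lambda>R. ennreal s * emeasure lebesgue R < (\<integral>\<^sup>+x\<in>R. h x \<partial>lebesgue)", OF this *]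
    obtain R where "R \<in> F" "dyad c l k x \<subseteq> R"
      unfolding F_def by blast
    then have "x \<in> \<Union>F" using dyad_self by blast
    with x show False by (simp add: G_def)
  qed
  have null: "emeasure lebesgue {x\<in>G. ennreal (s + e) \<le> h x} = 0" if e: "e > 0" for e
  proof (rule ccontr)
    define E where "E = {x\<in>G. ennreal (s + e) \<le> h x}"
    assume pos: "emeasure lebesgue {x\<in>G. ennreal (s + e) \<le> h x} \<noteq> 0"
    have [measurable]: "E \<in> sets lebesgue"
      unfolding E_def by measurable
    have "emeasure lebesgue E \<le> emeasure lebesgue (cube c l)"
      unfolding E_def G_def using cube_borel by (intro emeasure_mono) auto
    also have "\<dots> < \<infinity>" using l by (simp only: emeasure_cube) simp
    finally have fin: "emeasure lebesgue E < \<infinity>" .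
    define m where "m = measure lebesgue E"
    have m: "emeasure lebesgue E = ennreal m" "m \<ge> 0"
      unfolding m_def using fin by (simp_all add: emeasure_eq_ennreal_measure less_top)
    have mpos: "m > 0"
      using pos m by (metis E_def ennreal_0 less_le)
    \<comment> \<open>Chosen so that \<open>s * d < e * m\<close>, which contradicts the comparison
      of averages below; \<open>s + 1\<close> keeps the denominator positive when
      \<open>s = 0\<close>.\<close>
    define d where "d = e * m / (2 * (s + 1))"
    have d: "d > 0" using e mpos s by (simp add: d_def)
    obtain U where U: "open U" "E \<subseteq> U" "U - E \<in> lmeasurable" "emeasure lebesgue (U - E) < ennreal d"
      using sets_lebesgue_outer_open[OF \<open>E \<in> sets lebesgue\<close> d] by blast
    have UE: "U - E \<in> sets lebesgue" using U(3) by (rule fmeasurableD)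
    define V where "V = stop c l (\<lambda>R. R \<subseteq> U \<and> R \<inter> E \<noteq> {})"
    have V: "countable V" "V \<subseteq> sets lebesgue" "disjoint V"
      unfolding V_def by (rule countable_stop sets_stop stop_disjoint)+
    have [measurable]: "\<Union>V \<in> sets lebesgue" using V by (intro sets.countable_Union) auto
    have "E \<subseteq> \<Union>V"
    proof
      fix x assume x: "x \<in> E"
      then have xc: "x \<in> cube c l" by (simp add: E_def G_def)
      obtain k where k: "dyad c l k x \<subseteq> U" using dyad_subset_open[OF l U(1)] U(2) x by blast
      have "dyad c l k x \<inter> E \<noteq> {}" using x dyad_self by blast
      with k obtain R where "R \<in> V" "dyad c l k x \<subseteq> R"
        unfolding V_def using stop_cover[OF xc, of "\<lambda>R. R \<subseteq> U \<and> R \<inter> E \<noteq> {}" k] by blast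
      then show "x \<in> \<Union>V" using dyad_self by blast
    qed
    have VU: "\<Union>V \<subseteq> U" unfolding V_def using stop_P by blast
    have "ennreal ((s + e) * m) = (\<integral>\<^sup>+x. ennreal (s + e) * indicator E x \<partial>lebesgue)"
      using m s e by (simp add: nn_integral_cmult_indicator ennreal_mult)
    also have "\<dots> \<le> (\<integral>\<^sup>+x\<in>\<Union>V. h x \<partial>lebesgue)"
      using \<open>E \<subseteq> \<Union>V\<close> by (intro nn_integral_mono) (auto simp: E_def split: split_indicator)
    also have "\<dots> = (\<integral>\<^sup>+R. (\<integral>\<^sup>+x\<in>R. h x \<partial>lebesgue) \<partial>count_space V)"
      using V by (intro set_nn_integral_Union_disjoint) auto
    also have "\<dots> \<le> (\<integral>\<^sup>+R. ennreal s * emeasure lebesgue R \<partial>count_space V)"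
    proof (intro nn_integral_mono)
      fix R assume "R \<in> space (count_space V)"
      then have R: "R \<in> V" by simp
      then have "R \<inter> E \<noteq> {}" unfolding V_def by (auto dest: stop_P)
      then obtain y where y: "y \<in> R" "y \<in> E" by blast
      obtain k where "R = dyad c l k y" using stop_cases[OF R[unfolded V_def] y(1)] by blast
      then show "(\<integral>\<^sup>+x\<in>R. h x \<partial>lebesgue) \<le> ennreal s * emeasure lebesgue R"
        using avg y by (simp add: E_def)
    qed
    also have "\<dots> = ennreal s * emeasure lebesgue (\<Union>V)"
      using V by (simp add: nn_integral_cmult emeasure_Union_disjoint)
    also have "\<dots> \<le> ennreal s * (ennreal m + ennreal d)"
    proof (rule mult_left_mono)
      have "emeasure lebesgue (\<Union>V) \<le> emeasure lebesgue (E \<union> (U - E))"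
        using VU UE by (intro emeasure_mono sets.Un) auto
      also have "\<dots> \<le> emeasure lebesgue E + emeasure lebesgue (U - E)"
        using UE by (intro emeasure_subadditive) auto
      also have "\<dots> \<le> ennreal m + ennreal d"
        using m U(4) by (intro add_mono) auto
      finally show "emeasure lebesgue (\<Union>V) \<le> ennreal m + ennreal d" .
    qed simp
    also have "\<dots> = ennreal (s * (m + d))"
      using s m d by (simp add: ennreal_mult)
    finally have "(s + e) * m \<le> s * (m + d)"
      using s m d by (subst (asm) ennreal_le_iff) auto
    then have "e * m \<le> s * d" by (simp add: algebra_simps)
    also have "s * d < e * m"
    proof -
      have "s / (2 * (s + 1)) < 1" using s by (simp add: field_simps)
      then have "e * m * (s / (2 * (s + 1))) < e * m * 1"
        using e mpos by (intro mult_strict_left_mono) auto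
      then show ?thesis by (simp add: d_def mult.commute)
    qed
    finally show False by simp
  qed
  have "AE x in lebesgue. \<forall>n::nat. \<not> (x \<in> G \<and> ennreal (s + 1 / Suc n) \<le> h x)"
    unfolding AE_all_countable
  proof
    fix n :: nat
    show "AE x in lebesgue. \<not> (x \<in> G \<and> ennreal (s + 1 / Suc n) \<le> h x)"
      by (rule AE_I[OF _ null[of "1 / Suc n"]]) auto
  qed
  then show ?thesis
  proof (rule AE_mp, intro AE_I2 impI)
    fix x assume *: "\<forall>n::nat. \<not> (x \<in> G \<and> ennreal (s + 1 / Suc n) \<le> h x)" and x: "x \<in> cube c l - \<Union>F"
    show "h x \<le> ennreal s"
    proof (rule ccontr)
      assume "\<not> h x \<le> ennreal s"
      then have "\<exists>n::nat. ennreal (s + 1 / Suc n) \<le> h x"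
      proof (cases "h x")
        case (real u)
        then have "u - s > 0" using \<open>\<not> h x \<le> ennreal s\<close> s by (simp add: not_le ennreal_less_iff)
        then obtain n where "1 / Suc n < u - s" using nat_approx_posE by blast
        then show ?thesis using real by (intro exI[of _ n]) (auto intro: ennreal_leI)
      qed auto
      with * x show False by (auto simp: G_def)
    qed
  qed
qed

text \<open>The Calderon--Zygmund cubes: maximal dyadic subcubes on which the average of
  \<open>h\<close> exceeds \<open>s\<close>, written as a product to avoid dividing in
  \<open>ennreal\<close>.\<close>

definition cz :: "real ^ 'n \<Rightarrow> real \<Rightarrow> (real ^ 'n \<Rightarrow> ennreal) \<Rightarrow> real \<Rightarrow> (real ^ 'n) set set" where
  "cz c l h s = stop c l (\<lambda>R. ennreal s * emeasure lebesgue R < (\<integral>\<^sup>+x\<in>R. h x \<partial>lebesgue))"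

context
  fixes c :: "real ^ 'n" and l :: real and h :: "real ^ 'n \<Rightarrow> ennreal"
  assumes l: "l > 0" and h [measurable]: "h \<in> borel_measurable lebesgue"
begin

lemma cz_family: "subcube_family (cube c l) (cz c l h s)"
  unfolding cz_def using l by (rule stop_family)

lemma cz_cubes: "R \<in> cz c l h s \<Longrightarrow> R \<in> cubes"
  and cz_subset: "R \<in> cz c l h s \<Longrightarrow> R \<subseteq> cube c l"
  and cz_disjoint: "disjoint (cz c l h s)"
  using cz_family by (auto simp: subcube_family_def)

lemma cz_countable: "countable (cz c l h s)"
  unfolding cz_def by (rule countable_stop)

lemma cz_sets: "cz c l h s \<subseteq> sets lebesgue"
  using cz_cubes cubes_lebesgue by blast

lemma cz_Union_sets: "\<Union>(cz c l h s) \<in> sets lebesgue"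
  using cz_sets cz_countable by (intro sets.countable_Union) auto

lemma cz_AE_le: "s \<ge> 0 \<Longrightarrow> AE x in lebesgue. x \<in> cube c l - \<Union>(cz c l h s) \<longrightarrow> h x \<le> ennreal s"
  unfolding cz_def using l h by (rule AE_le_outside_stop)

lemma cz_gt: "R \<in> cz c l h s \<Longrightarrow> ennreal s * emeasure lebesgue R < (\<integral>\<^sup>+x\<in>R. h x \<partial>lebesgue)"
  unfolding cz_def by (rule stop_P)

text \<open>The second assumption says that the whole cube is not selected. Hence each selected cube
  has a rejected parent, whose average is at most \<open>s\<close> and whose measure is 2^n times as
  large.\<close>

lemma cz_le:
  assumes "R \<in> cz c l h s"
    and "(\<integral>\<^sup>+x\<in>cube c l. h x \<partial>lebesgue) \<le> ennreal s * emeasure lebesgue (cube c l)"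
  shows "(\<integral>\<^sup>+x\<in>R. h x \<partial>lebesgue) \<le> ennreal (2 ^ CARD('n) * s) * emeasure lebesgue R"
proof -
  obtain S where S: "R \<subseteq> S" "(\<integral>\<^sup>+x\<in>S. h x \<partial>lebesgue) \<le> ennreal s * emeasure lebesgue S"
    "emeasure lebesgue S = 2 ^ CARD('n) * emeasure lebesgue R"
  proof (rule stop_parent[OF l assms(1)[unfolded cz_def]])
    show "\<not> ennreal s * emeasure lebesgue (cube c l) < (\<integral>\<^sup>+x\<in>cube c l. h x \<partial>lebesgue)"
      using assms(2) by (simp only: not_less)
  qed (simp_all only: not_less)
  have two: "ennreal (2 ^ CARD('n) * s) = 2 ^ CARD('n) * ennreal s"
    by (simp add: ennreal_mult' flip: ennreal_power)
  have "(\<integral>\<^sup>+x\<in>R. h x \<partial>lebesgue) \<le> (\<integral>\<^sup>+x\<in>S. h x \<partial>lebesgue)"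
    using S(1) by (intro nn_integral_mono) (auto split: split_indicator)
  also have "\<dots> \<le> ennreal (2 ^ CARD('n) * s) * emeasure lebesgue R"
    using S(2,3) unfolding two by (simp add: mult_ac)
  finally show ?thesis .
qed

text \<open>The weak (1,1) inequality for the dyadic maximal function, obtained by summing
  \<open>cz_gt\<close> over the disjoint selected cubes.\<close>

lemma cz_emeasure_le:
  "ennreal s * emeasure lebesgue (\<Union>(cz c l h s)) \<le> (\<integral>\<^sup>+x\<in>cube c l. h x \<partial>lebesgue)"
proof -
  note [simp] = cz_countable cz_sets cz_disjoint
  have "ennreal s * emeasure lebesgue (\<Union>(cz c l h s)) =
      (\<integral>\<^sup>+R. ennreal s * emeasure lebesgue R \<partial>count_space (cz c l h s))"
    by (simp add: nn_integral_cmult emeasure_Union_disjoint)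
  also have "\<dots> \<le> (\<integral>\<^sup>+R. (\<integral>\<^sup>+x\<in>R. h x \<partial>lebesgue) \<partial>count_space (cz c l h s))"
    using cz_gt by (intro nn_integral_mono) (auto intro: less_imp_le)
  also have "\<dots> = (\<integral>\<^sup>+x\<in>\<Union>(cz c l h s). h x \<partial>lebesgue)"
    by (rule set_nn_integral_Union_disjoint[symmetric]) auto
  also have "\<dots> \<le> (\<integral>\<^sup>+x\<in>cube c l. h x \<partial>lebesgue)"
    using cz_subset by (intro nn_integral_mono) (auto split: split_indicator)
  finally show ?thesis .
qed

lemma cz_nested:
  assumes "s \<le> s'" "R' \<in> cz c l h s'" "R \<in> cz c l h s" "R \<inter> R' \<noteq> {}"
  shows "R' \<subseteq> R"
  using assms(2,3,4) unfolding cz_def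
proof (rule stop_nested[rotated])
  fix S :: "(real ^ 'n) set"
  have "ennreal s * emeasure lebesgue S \<le> ennreal s' * emeasure lebesgue S"
    using assms(1) by (intro mult_right_mono ennreal_leI) auto
  then show "ennreal s' * emeasure lebesgue S < (\<integral>\<^sup>+x\<in>S. h x \<partial>lebesgue) \<Longrightarrow>
      ennreal s * emeasure lebesgue S < (\<integral>\<^sup>+x\<in>S. h x \<partial>lebesgue)"
    by (rule le_less_trans)
qed

end

lemma cz_Union_antimono:
  fixes c :: "real ^ 'n"
  assumes "s \<le> s'"
  shows "\<Union>(cz c l h s') \<subseteq> \<Union>(cz c l h s)"
  unfolding cz_def
proof (rule stop_Union_mono)
  fix S :: "(real ^ 'n) set"
  have "ennreal s * emeasure lebesgue S \<le> ennreal s' * emeasure lebesgue S"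
    using assms by (intro mult_right_mono ennreal_leI) auto
  then show "ennreal s' * emeasure lebesgue S < (\<integral>\<^sup>+x\<in>S. h x \<partial>lebesgue) \<Longrightarrow>
      ennreal s * emeasure lebesgue S < (\<integral>\<^sup>+x\<in>S. h x \<partial>lebesgue)"
    by (rule le_less_trans)
qed

subsection \<open>Averages and weighted measures\<close>

text \<open>The truncations to balls of radius \<open>k\<close> are integrable and converge
  pointwise, being eventually constant at each point.\<close>

lemma locally_integrable_measurable:
  fixes f :: "real ^ 'n \<Rightarrow> real"
  assumes "locally_integrable f"
  shows "f \<in> borel_measurable lebesgue"
proof (rule borel_measurable_LIMSEQ_real)
  fix k :: nat
  have "f absolutely_integrable_on cball 0 (real k)"
    using assms by (auto simp: locally_integrable_def)
  then have "integrable lebesgue (\<lambda>x. indicator (cball 0 (real k)) x *\<^sub>R f x)"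
    by (simp only: set_integrable_def)
  then show "(\<lambda>x. indicator (cball 0 (real k)) x *\<^sub>R f x) \<in> borel_measurable lebesgue"
    by (rule borel_measurable_integrable)
next
  fix x :: "real ^ 'n"
  obtain m :: nat where m: "norm x \<le> real m" using real_arch_simple by blast
  have "\<forall>k\<ge>m. indicator (cball 0 (real k)) x *\<^sub>R f x = f x"
    using m by auto
  then show "(\<lambda>k. indicator (cball 0 (real k)) x *\<^sub>R f x) \<longlonglongrightarrow> f x"
    by (intro tendsto_eventually) (auto simp: eventually_sequentially)
qed

lemma locally_integrable_on_cube:
  fixes f :: "real ^ 'n \<Rightarrow> real"
  assumes "locally_integrable f" "Q \<in> cubes"
  shows "set_integrable lebesgue Q f"
proof -
  obtain c l where Q: "Q = cube c l" using assms(2) by (rule cubesE)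
  let ?K = "cbox c (c + l *\<^sub>R One)"
  have "set_integrable lebesgue ?K f"
    using assms(1) compact_cbox unfolding locally_integrable_def by blast
  then show ?thesis
    by (rule set_integrable_subset) (use Q cube_between(2) assms(2) cubes_lebesgue in auto)
qed

lemma set_integrable_const_cube:
  "(Q :: (real ^ 'n) set) \<in> cubes \<Longrightarrow> set_integrable lebesgue Q (\<lambda>x. v :: real)"
  using cubes_lebesgue[of Q] cubes_emeasure[of Q]
  by (simp add: set_integrable_def integrable_mult_left)

lemma avg_mult_emeasure:
  assumes "Q \<in> cubes" "set_integrable lebesgue Q g" "\<And>x. g x \<ge> 0"
  shows "ennreal (avg Q g) * emeasure lebesgue Q = (\<integral>\<^sup>+x\<in>Q. ennreal (g x) \<partial>lebesgue)"
proof -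
  have "(\<integral>\<^sup>+x\<in>Q. ennreal (g x) \<partial>lebesgue) = (\<integral>\<^sup>+x. ennreal (indicator Q x *\<^sub>R g x) \<partial>lebesgue)"
    by (intro nn_integral_cong) (auto split: split_indicator)
  also have "\<dots> = ennreal (LINT x:Q|lebesgue. g x)"
    using assms unfolding set_integrable_def set_lebesgue_integral_def
    by (intro nn_integral_eq_integral) (auto split: split_indicator)
  also have "\<dots> = ennreal (avg Q g * measure lebesgue Q)"
    using cubes_emeasure[OF assms(1)] by (simp add: avg_def)
  also have "\<dots> = ennreal (avg Q g) * emeasure lebesgue Q"
  proof -
    have "avg Q g \<ge> 0"
      unfolding avg_def set_lebesgue_integral_def using assms
      by (intro divide_nonneg_nonneg Bochner_Integration.integral_nonneg) (auto split: split_indicator)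
    then show ?thesis
      unfolding cubes_emeasure(1)[OF assms(1)] by (rule ennreal_mult) simp
  qed
  finally show ?thesis ..
qed

lemma avg_dist_mult_emeasure_le:
  assumes "R \<in> cubes" "set_integrable lebesgue R f"
  shows "ennreal \<bar>avg R f - v\<bar> * emeasure lebesgue R \<le> (\<integral>\<^sup>+x\<in>R. ennreal \<bar>f x - v\<bar> \<partial>lebesgue)"
proof -
  have d: "set_integrable lebesgue R (\<lambda>x. f x - v)"
    by (intro set_integral_diff assms set_integrable_const_cube)
  have "avg R f - v = (LINT x:R|lebesgue. f x - v) / measure lebesgue R"
  proof -
    have "(LINT x:R|lebesgue. v) = v * measure lebesgue R"
      using cubes_lebesgue[OF assms(1)] cubes_emeasure[OF assms(1)]
      by (simp add: set_lebesgue_integral_def)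
    then show ?thesis
      using cubes_emeasure(2)[OF assms(1)]
      by (simp add: avg_def set_integral_diff(2)[OF assms(2) set_integrable_const_cube[OF assms(1)]] diff_divide_distrib)
  qed
  also have "\<bar>\<dots>\<bar> \<le> avg R (\<lambda>x. \<bar>f x - v\<bar>)"
    unfolding avg_def abs_divide
    using set_integral_norm_bound[OF d] cubes_emeasure(2)[OF assms(1)]
    by (simp add: divide_right_mono)
  finally have "ennreal \<bar>avg R f - v\<bar> * emeasure lebesgue R
      \<le> ennreal (avg R (\<lambda>x. \<bar>f x - v\<bar>)) * emeasure lebesgue R"
    by (intro mult_right_mono ennreal_leI) auto
  also have "\<dots> = (\<integral>\<^sup>+x\<in>R. ennreal \<bar>f x - v\<bar> \<partial>lebesgue)"
    using set_integrable_abs[OF d] by (intro avg_mult_emeasure assms) auto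
  finally show ?thesis .
qed

text \<open>The sum is at most twice the larger term. The resulting crude constant
  \<open>2 powr p\<close> is the one that enters \<open>LpC\<close>.\<close>

lemma powr_add_le:
  fixes u v p :: real
  assumes "u \<ge> 0" "v \<ge> 0" "p \<ge> 0"
  shows "(u + v) powr p \<le> 2 powr p * (u powr p + v powr p)"
proof -
  have "(u + v) powr p \<le> (2 * max u v) powr p"
    using assms by (intro powr_mono2) auto
  also have "\<dots> = 2 powr p * max u v powr p"
    using assms by (simp add: powr_mult)
  also have "\<dots> \<le> 2 powr p * (u powr p + v powr p)"
    by (intro mult_left_mono) (auto simp: max_def)
  finally show ?thesis .
qed

lemma ennreal_mult_right_le_cancel:
  fixes a b c :: ennreal
  assumes "a * c \<le> b * c" "0 < c" "c < \<infinity>"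
  shows "a \<le> b"
  using assms by (simp add: mult.commute[of _ c] ennreal_mult_le_mult_iff)

lemma ennreal_mult_left_le_cancel:
  fixes b c :: ennreal
  assumes "ennreal k * b \<le> ennreal k * c" "k > 0"
  shows "b \<le> c"
  using assms by (simp add: ennreal_mult_le_mult_iff)

section \<open>The measure w dx, and the hypotheses on \<open>a\<close> as integrals over counting
  measures\<close>

abbreviation wm :: "(real ^ 'n \<Rightarrow> real) \<Rightarrow> (real ^ 'n) measure" where
  "wm w \<equiv> density lebesgue (\<lambda>x. ennreal (w x))"

lemma emeasure_wm:
  assumes "weight w" "Q \<in> cubes" "E \<subseteq> Q" "E \<in> sets lebesgue"
  shows "emeasure (wm w) E = ennreal (wmeas w E)"
proof -
  have w [measurable]: "w \<in> borel_measurable lebesgue"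
    using assms by (auto simp: weight_def intro: locally_integrable_measurable)
  have int: "set_integrable lebesgue E w"
    by (rule set_integrable_subset[of _ Q])
      (use assms in \<open>auto simp: weight_def intro!: locally_integrable_on_cube\<close>)
  have "emeasure (wm w) E = (\<integral>\<^sup>+x. ennreal (indicator E x *\<^sub>R w x) \<partial>lebesgue)"
    using assms(4) by (subst emeasure_density) (auto intro!: nn_integral_cong split: split_indicator)
  also have "\<dots> = ennreal (wmeas w E)"
    unfolding wmeas_def set_lebesgue_integral_def
    using int assms(1) unfolding set_integrable_def
    by (intro nn_integral_eq_integral) (auto simp: weight_def split: split_indicator)
  finally show ?thesis .
qed

lemma wmeas_nonneg: "weight w \<Longrightarrow> wmeas w E \<ge> 0"
  unfolding wmeas_def set_lebesgue_integral_def
  by (intro Bochner_Integration.integral_nonneg) (auto simp: weight_def split: split_indicator)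

text \<open>Disjointness turns the sum of the measures into the measure of the union, which is the
  quantity that the Calderon--Zygmund decomposition controls. The product form of the last
  assumption matches \<open>cz_emeasure_le\<close>.\<close>

lemma small_condition_countable:
  fixes w :: "real ^ 'n \<Rightarrow> real"
  assumes "small_condition p w a" "weight w" "Q \<in> cubes" "subcube_family Q F" "countable F" "L > 1"
    and "ennreal L * emeasure lebesgue (\<Union>F) \<le> emeasure lebesgue Q"
  shows "(\<integral>\<^sup>+R. ennreal (a R powr p) * emeasure (wm w) R \<partial>count_space F)
    \<le> ennreal ((1 / L) powr (p / real CARD('n)) * a Q powr p) * emeasure (wm w) Q"
proof -
  have F: "F \<subseteq> cubes" "\<And>R. R \<in> F \<Longrightarrow> R \<subseteq> Q" "disjoint F"
    using assms(4) by (auto simp: subcube_family_def)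
  have Fs: "F \<subseteq> sets lebesgue" using F cubes_lebesgue by blast
  have eq: "ennreal (a R powr p) * emeasure (wm w) R = ennreal (a R powr p * wmeas w R)"
    if "R \<in> cubes" "R \<subseteq> Q" for R
    using that assms(2,3) by (subst emeasure_wm[of w Q]) (auto simp: ennreal_mult wmeas_nonneg cubes_lebesgue)
  have "ennreal (1 / L) * (ennreal L * emeasure lebesgue (\<Union>F)) \<le> ennreal (1 / L) * emeasure lebesgue Q"
    by (intro mult_left_mono assms) auto
  moreover have "ennreal (1 / L) * (ennreal L * x) = x" for x
    using assms(6) by (simp flip: mult.assoc ennreal_mult)
  moreover have "ennreal (1 / L) * emeasure lebesgue Q = ennreal (measure lebesgue Q / L)"
    unfolding cubes_emeasure(1)[OF assms(3)] using assms(6) by (simp flip: ennreal_mult)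
  ultimately have "emeasure lebesgue (\<Union>F) \<le> ennreal (measure lebesgue Q / L)"
    by simp
  then have "infsum (emeasure lebesgue) F \<le> ennreal (measure lebesgue Q / L)"
    using Fs F assms(5) by (simp add: emeasure_Union_disjoint nn_integral_count_space_eq_infsum)
  with assms have "(\<Sum>\<^sub>\<infinity>P\<in>F. ennreal (a P powr p * wmeas w P))
        \<le> ennreal ((1 / L) powr (p / real CARD('n)) * a Q powr p * wmeas w Q)"
    unfolding small_condition_def by blast
  also have "\<dots> = ennreal ((1 / L) powr (p / real CARD('n)) * a Q powr p) * emeasure (wm w) Q"
    using assms(2,3) by (subst emeasure_wm[of w Q]) (auto simp: ennreal_mult wmeas_nonneg cubes_lebesgue)
  also have "(\<Sum>\<^sub>\<infinity>P\<in>F. ennreal (a P powr p * wmeas w P)) =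
      (\<integral>\<^sup>+R. ennreal (a R powr p) * emeasure (wm w) R \<partial>count_space F)"
    unfolding nn_integral_count_space_eq_infsum[OF assms(5)]
    using F eq by (intro infsum_cong) auto
  finally show ?thesis .
qed

lemma D_condition_countable:
  fixes w :: "real ^ 'n \<Rightarrow> real"
  assumes "D_condition r w a A" "weight w" "Q \<in> cubes" "subcube_family Q F" "countable F"
  shows "(\<integral>\<^sup>+R. ennreal (a R powr r) * emeasure (wm w) R \<partial>count_space F)
    \<le> ennreal (A powr r * a Q powr r) * emeasure (wm w) Q"
proof -
  have F: "F \<subseteq> cubes" "\<And>R. R \<in> F \<Longrightarrow> R \<subseteq> Q"
    using assms(4) by (auto simp: subcube_family_def)
  have eq: "ennreal (a R powr r) * emeasure (wm w) R = ennreal (a R powr r * wmeas w R)"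
    if "R \<in> cubes" "R \<subseteq> Q" for R
    using that assms(2,3) by (subst emeasure_wm[of w Q]) (auto simp: ennreal_mult wmeas_nonneg cubes_lebesgue)
  have "(\<integral>\<^sup>+R. ennreal (a R powr r) * emeasure (wm w) R \<partial>count_space F) =
      (\<Sum>\<^sub>\<infinity>P\<in>F. ennreal (a P powr r * wmeas w P))"
    unfolding nn_integral_count_space_eq_infsum[OF assms(5)]
    using F eq by (intro infsum_cong) auto
  also have "\<dots> \<le> ennreal (A powr r * a Q powr r * wmeas w Q)"
    using assms unfolding D_condition_def by blast
  also have "\<dots> = ennreal (A powr r * a Q powr r) * emeasure (wm w) Q"
    using assms(2,3) by (subst emeasure_wm[of w Q]) (auto simp: ennreal_mult wmeas_nonneg cubes_lebesgue)
  finally show ?thesis .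
qed

subsection \<open>The strong estimate\<close>

text \<open>The solution of \<open>C = 2 powr p * K powr p + C * 2 powr - p\<close> with \<open>K = 2 ^ n * 4 ^ n\<close>: this is
  the fixed point of the recursion obtained by one Calderon--Zygmund step at relative height
  \<open>4 ^ n\<close>, where the smallness condition gains the factor \<open>4 powr - p\<close>.\<close>

definition LpC :: "nat \<Rightarrow> real \<Rightarrow> real" where
  "LpC n p = 2 powr p * (2 ^ n * 4 ^ n) powr p / (1 - 2 powr - p)"

locale poincare =
  fixes w f :: "real ^ 'n \<Rightarrow> real" and a :: "(real ^ 'n) set \<Rightarrow> real" and p :: real
  assumes w: "weight w" and f: "locally_integrable f" and p: "p \<ge> 1"
    and a_pos: "Q \<in> cubes \<Longrightarrow> a Q > 0"
    and small: "small_condition p w a"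
    and oscillation: "Q \<in> cubes \<Longrightarrow> avg Q (\<lambda>x. \<bar>f x - avg Q f\<bar>) \<le> a Q"
begin

definition osc :: "(real ^ 'n) set \<Rightarrow> real ^ 'n \<Rightarrow> real" where
  "osc Q x = \<bar>f x - avg Q f\<bar>"

lemma w_measurable [measurable]: "w \<in> borel_measurable lebesgue"
  using w by (auto simp: weight_def intro: locally_integrable_measurable)

text \<open>The measure w dx is absolutely continuous, so exceptional sets need only be null for
  Lebesgue measure.\<close>

lemma AE_wm:
  assumes "AE x in lebesgue. P x"
  shows "AE x in wm w. P x"
proof -
  have "(AE x in wm w. P x) \<longleftrightarrow> (AE x in lebesgue. 0 < ennreal (w x) \<longrightarrow> P x)"
    by (rule AE_density) measurable
  moreover have "AE x in lebesgue. 0 < ennreal (w x) \<longrightarrow> P x"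
    using assms by (rule eventually_mono) simp
  ultimately show ?thesis by simp
qed

lemma osc_measurable [measurable]: "osc Q \<in> borel_measurable lebesgue"
  using locally_integrable_measurable[OF f] unfolding osc_def by measurable

lemma osc_nonneg: "osc Q x \<ge> 0"
  by (simp add: osc_def)

lemma osc_le_osc: "osc Q x \<le> \<bar>avg R f - avg Q f\<bar> + osc R x"
  by (simp add: osc_def)

lemma nn_integral_osc_le:
  assumes "Q \<in> cubes"
  shows "(\<integral>\<^sup>+x\<in>Q. ennreal (osc Q x) \<partial>lebesgue) \<le> ennreal (a Q) * emeasure lebesgue Q"
proof -
  have "set_integrable lebesgue Q (\<lambda>x. \<bar>f x - avg Q f\<bar>)"
    by (intro set_integrable_abs set_integral_diff locally_integrable_on_cube f assms set_integrable_const_cube)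
  then have "(\<integral>\<^sup>+x\<in>Q. ennreal (osc Q x) \<partial>lebesgue) =
      ennreal (avg Q (\<lambda>x. \<bar>f x - avg Q f\<bar>)) * emeasure lebesgue Q"
    unfolding osc_def by (rule avg_mult_emeasure[OF assms, symmetric]) simp
  also have "\<dots> \<le> ennreal (a Q) * emeasure lebesgue Q"
    by (intro mult_right_mono ennreal_leI oscillation assms) auto
  finally show ?thesis .
qed

lemma avg_diff_le:
  assumes "R \<in> cubes" "(\<integral>\<^sup>+x\<in>R. ennreal (osc Q x) \<partial>lebesgue) \<le> ennreal v * emeasure lebesgue R" "v \<ge> 0"
  shows "\<bar>avg R f - avg Q f\<bar> \<le> v"
proof -
  have "ennreal \<bar>avg R f - avg Q f\<bar> * emeasure lebesgue R \<le> ennreal v * emeasure lebesgue R"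
    using avg_dist_mult_emeasure_le[OF assms(1) locally_integrable_on_cube[OF f assms(1)], of "avg Q f"] assms(2)
    unfolding osc_def by (rule order_trans)
  then have "ennreal \<bar>avg R f - avg Q f\<bar> \<le> ennreal v"
    by (rule ennreal_mult_right_le_cancel[OF _ cubes_emeasure(3,4)[OF assms(1)]])
  then show ?thesis using assms(3) by (simp add: ennreal_le_iff)
qed

lemma two_powr_less_1: "2 powr - p < 1"
  using p powr_less_mono[of "- p" 0 2] by simp

lemma LpC_pos: "LpC CARD('n) p > 0"
  using two_powr_less_1 p by (simp add: LpC_def)

text \<open>Solving the recursion needs the contraction factor
  \<open>2 powr p * 4 powr - p = 2 powr - p\<close>, which is less than 1.\<close>

lemma LpC_eq: "2 powr p * (2 ^ CARD('n) * 4 ^ CARD('n)) powr p + 2 powr p * (LpC CARD('n) p * 4 powr - p) = LpC CARD('n) p"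
proof -
  have "(4::real) powr - p = (2 powr 2) powr - p" by simp
  also have "\<dots> = 2 powr - p * 2 powr - p" by (simp only: powr_powr flip: powr_add) simp
  finally have *: "2 powr p * 4 powr - p = (2 powr - p :: real)"
    by (simp flip: powr_add mult.assoc)
  have "2 powr p * (LpC CARD('n) p * 4 powr - p) = LpC CARD('n) p * (2 powr p * 4 powr - p)"
    by (rule mult.left_commute)
  then have "2 powr p * (LpC CARD('n) p * 4 powr - p) = LpC CARD('n) p * 2 powr - p"
    unfolding * .
  moreover have "2 powr p * (2 ^ CARD('n) * 4 ^ CARD('n)) powr p = LpC CARD('n) p * (1 - 2 powr - p)"
    using two_powr_less_1 p by (simp add: LpC_def)
  ultimately show ?thesis by (simp only: right_diff_distrib)
qed

text \<open>Each step of the induction is one Calderon--Zygmund decomposition at height \<open>4 ^ n * a Q\<close>.\<close>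

lemma Lp_bound_off_exceptional_set:
  assumes "Q \<in> cubes"
  shows "\<exists>E\<in>sets lebesgue. E \<subseteq> Q \<and>
    ennreal ((4 ^ CARD('n)) ^ m) * emeasure lebesgue (Q - E) \<le> emeasure lebesgue Q \<and>
    (\<integral>\<^sup>+x\<in>E. ennreal (osc Q x powr p) \<partial>wm w) \<le> ennreal (LpC CARD('n) p * a Q powr p) * emeasure (wm w) Q"
  using assms
proof (induction m arbitrary: Q)
  case 0
  \<comment> \<open>Before any decomposition the exceptional set is all of \<open>Q\<close>.\<close>
  show ?case by (rule bexI[of _ "{}"]) auto
next
  case (Suc m)
  define L :: real where "L = 4 ^ CARD('n)"
  have L: "L > 1" by (simp add: L_def one_less_power)
  obtain c l where l: "l > 0" and Q: "Q = cube c l" using Suc.prems by (rule cubesE)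
  have a: "a Q > 0" using a_pos Suc.prems .
  define h where "h x = ennreal (osc Q x)" for x
  have h [measurable]: "h \<in> borel_measurable lebesgue" unfolding h_def by measurable
  define s where "s = L * a Q"
  have s: "s > 0" using L a by (simp add: s_def)
  have as: "a Q \<le> s" using L a by (simp add: s_def)
  define F where "F = cz c l h s"
  note F_cubes = cz_cubes[OF l h, of _ c s, folded F_def]
    and F_sub = cz_subset[OF l h, of _ c s, folded F_def Q]
    and F_disj = cz_disjoint[OF l h, of c s, folded F_def]
    and F_count = cz_countable[OF l h, of c s, folded F_def]
    and F_sets = cz_sets[OF l h, of c s, folded F_def]
    and F_fam = cz_family[OF l h, of c s, folded F_def Q]
    and UF [measurable] = cz_Union_sets[OF l h, of c s, folded F_def]
  have Qs [measurable]: "Q \<in> sets lebesgue" using Suc.prems by (rule cubes_lebesgue)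
  have hQ: "(\<integral>\<^sup>+x\<in>Q. h x \<partial>lebesgue) \<le> ennreal (a Q) * emeasure lebesgue Q"
    unfolding h_def using Suc.prems by (rule nn_integral_osc_le)
  have hQs: "(\<integral>\<^sup>+x\<in>Q. h x \<partial>lebesgue) \<le> ennreal s * emeasure lebesgue Q"
    using as by (intro order_trans[OF hQ] mult_right_mono ennreal_leI) auto
  \<comment> \<open>\<open>K\<close> is 2^n times the height \<open>s\<close>. It bounds the jump of
    the average from \<open>Q\<close> to a stopping cube and, being at least \<open>s\<close>, also
    the oscillation outside the stopping cubes.\<close>
  define K where "K = 2 ^ CARD('n) * L * a Q"
  have K: "K > 0" using L a by (simp add: K_def)
  have sK: "s \<le> K"
  proof -
    have "1 * s \<le> 2 ^ CARD('n) * s" using s by (intro mult_right_mono) auto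
    then show ?thesis by (simp add: K_def s_def mult.assoc)
  qed
  have jump: "\<bar>avg R f - avg Q f\<bar> \<le> K" if "R \<in> F" for R
  proof (rule avg_diff_le[OF F_cubes[OF that]])
    show "(\<integral>\<^sup>+x\<in>R. ennreal (osc Q x) \<partial>lebesgue) \<le> ennreal K * emeasure lebesgue R"
      using cz_le[OF l h that[unfolded F_def] hQs[unfolded Q]]
      unfolding h_def K_def s_def by (simp add: mult.assoc)
  qed (use K in simp)
  have meas: "ennreal L * emeasure lebesgue (\<Union>F) \<le> emeasure lebesgue Q"
  proof (rule ennreal_mult_right_le_cancel)
    have "ennreal L * emeasure lebesgue (\<Union>F) * ennreal (a Q) = ennreal s * emeasure lebesgue (\<Union>F)"
      using L a by (simp add: s_def ennreal_mult mult_ac)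
    also have "\<dots> \<le> (\<integral>\<^sup>+x\<in>Q. h x \<partial>lebesgue)"
      unfolding F_def Q by (rule cz_emeasure_le[OF l h])
    finally show "ennreal L * emeasure lebesgue (\<Union>F) * ennreal (a Q) \<le> emeasure lebesgue Q * ennreal (a Q)"
      using hQ by (simp add: mult.commute)
  qed (use a in auto)
  have "\<forall>R\<in>F. \<exists>E. E \<in> sets lebesgue \<and> E \<subseteq> R \<and>
      ennreal (L ^ m) * emeasure lebesgue (R - E) \<le> emeasure lebesgue R \<and>
      (\<integral>\<^sup>+x\<in>E. ennreal (osc R x powr p) \<partial>wm w) \<le> ennreal (LpC CARD('n) p * a R powr p) * emeasure (wm w) R"
    (is "\<forall>R\<in>F. \<exists>E. ?good R E")
  proof
    fix R assume "R \<in> F"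
    from Suc.IH[OF F_cubes[OF this], folded L_def] show "\<exists>E. ?good R E" by (simp only: Bex_def)
  qed
  then have "\<exists>E. \<forall>R\<in>F. ?good R (E R)" by (rule bchoice)
  then obtain E where "\<forall>R\<in>F. ?good R (E R)" ..
  then have E: "\<And>R. R \<in> F \<Longrightarrow> E R \<in> sets lebesgue" "\<And>R. R \<in> F \<Longrightarrow> E R \<subseteq> R"
    "\<And>R. R \<in> F \<Longrightarrow> ennreal (L ^ m) * emeasure lebesgue (R - E R) \<le> emeasure lebesgue R"
    "\<And>R. R \<in> F \<Longrightarrow> (\<integral>\<^sup>+x\<in>E R. ennreal (osc R x powr p) \<partial>wm w) \<le> ennreal (LpC CARD('n) p * a R powr p) * emeasure (wm w) R"
    by blast+
  define V where "V = (\<Union>R\<in>F. E R)"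
  have V [measurable]: "V \<in> sets lebesgue"
    unfolding V_def using F_count E(1) by (intro sets.countable_UN') auto
  have E_disj: "disjoint_family_on E F" "disjoint_family_on (\<lambda>R. R - E R) F"
    using F_disj E(2) unfolding disjoint_family_on_def disjoint_def by blast+
  \<comment> \<open>What remains outside \<open>?E\<close> are the exceptional parts of the stopping
    cubes. Their total measure gains one factor \<open>L\<close> from \<open>meas\<close> on top of
    the factor \<open>L ^ m\<close> from the induction hypothesis.\<close>
  let ?E = "(Q - \<Union>F) \<union> V"
  show ?case
  proof (intro bexI[of _ ?E] conjI)
    show "?E \<in> sets lebesgue" by measurable
    show "?E \<subseteq> Q" using E(2) F_sub by (auto simp: V_def)
    have "ennreal (L ^ Suc m) * emeasure lebesgue (Q - ?E) \<le>
        ennreal (L ^ Suc m) * emeasure lebesgue (\<Union>R\<in>F. R - E R)"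
      using F_count E(1) F_sets
      by (intro mult_left_mono emeasure_mono sets.countable_UN') (auto simp: V_def)
    also have "emeasure lebesgue (\<Union>R\<in>F. R - E R) = (\<integral>\<^sup>+R. emeasure lebesgue (R - E R) \<partial>count_space F)"
      using F_count E(1) F_sets E_disj by (intro emeasure_UN_countable) auto
    also have "ennreal (L ^ Suc m) * \<dots> =
        ennreal L * (\<integral>\<^sup>+R. ennreal (L ^ m) * emeasure lebesgue (R - E R) \<partial>count_space F)"
      using L by (simp add: nn_integral_cmult ennreal_mult mult.assoc)
    also have "\<dots> \<le> ennreal L * (\<integral>\<^sup>+R. emeasure lebesgue R \<partial>count_space F)"
      using E(3) by (intro mult_left_mono nn_integral_mono) auto
    also have "\<dots> = ennreal L * emeasure lebesgue (\<Union>F)"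
      using F_count F_sets F_disj by (simp add: emeasure_Union_disjoint)
    also note meas
    finally show "ennreal ((4 ^ CARD('n)) ^ Suc m) * emeasure lebesgue (Q - ?E) \<le> emeasure lebesgue Q"
      unfolding L_def .
    define k where "k = ennreal (2 powr p * K powr p)"
    \<comment> \<open>The same constant \<open>k\<close> is used here and on the stopping cubes, so
      that the two constant terms recombine below into \<open>k\<close> times the w-measure of the
      whole of \<open>Q\<close>.\<close>
    have near: "AE x in wm w. x \<in> Q - \<Union>F \<longrightarrow> ennreal (osc Q x powr p) \<le> k"
    proof -
      have "AE x in lebesgue. x \<in> Q - \<Union>F \<longrightarrow> h x \<le> ennreal s"
        unfolding Q F_def using s by (intro cz_AE_le[OF l h]) simp
      then have "AE x in lebesgue. x \<in> Q - \<Union>F \<longrightarrow> ennreal (osc Q x powr p) \<le> k"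
      proof (rule AE_mp, intro AE_I2 impI)
        fix x assume "x \<in> Q - \<Union>F \<longrightarrow> h x \<le> ennreal s" "x \<in> Q - \<Union>F"
        then have "osc Q x \<le> K" using s sK by (simp add: h_def ennreal_le_iff)
        then have "osc Q x powr p \<le> 1 * K powr p"
          using p osc_nonneg by (simp add: powr_mono2)
        also have "\<dots> \<le> 2 powr p * K powr p"
          using p by (intro mult_right_mono) (auto intro: ge_one_powr_ge_zero)
        finally show "ennreal (osc Q x powr p) \<le> k" unfolding k_def by (rule ennreal_leI)
      qed
      then show ?thesis by (rule AE_wm)
    qed
    have far: "ennreal (osc Q x powr p) \<le> k + ennreal (2 powr p) * ennreal (osc R x powr p)" if "R \<in> F" for x R
    proof -
      have "osc Q x powr p \<le> (K + osc R x) powr p"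
        using jump[OF that] osc_le_osc[of Q x R] p osc_nonneg by (intro powr_mono2) auto
      also have "\<dots> \<le> 2 powr p * (K powr p + osc R x powr p)"
        using K p osc_nonneg by (intro powr_add_le) auto
      finally have "ennreal (osc Q x powr p) \<le> ennreal (2 powr p * (K powr p + osc R x powr p))"
        by (rule ennreal_leI)
      then show ?thesis by (simp add: k_def distrib_left ennreal_mult)
    qed
    have "(\<integral>\<^sup>+x\<in>?E. ennreal (osc Q x powr p) \<partial>wm w) \<le>
        (\<integral>\<^sup>+x. ennreal (osc Q x powr p) * indicator (Q - \<Union>F) x + ennreal (osc Q x powr p) * indicator V x \<partial>wm w)"
      by (intro nn_integral_mono) (auto split: split_indicator)
    also have "\<dots> = (\<integral>\<^sup>+x\<in>Q - \<Union>F. ennreal (osc Q x powr p) \<partial>wm w) + (\<integral>\<^sup>+x\<in>V. ennreal (osc Q x powr p) \<partial>wm w)"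
      by (intro nn_integral_add) measurable
    also have "(\<integral>\<^sup>+x\<in>Q - \<Union>F. ennreal (osc Q x powr p) \<partial>wm w) \<le> (\<integral>\<^sup>+x. k * indicator (Q - \<Union>F) x \<partial>wm w)"
      by (intro nn_integral_mono_AE eventually_mono[OF near]) (auto split: split_indicator)
    also have "\<dots> = k * emeasure (wm w) (Q - \<Union>F)"
      by (intro nn_integral_cmult_indicator) simp
    also have "(\<integral>\<^sup>+x\<in>V. ennreal (osc Q x powr p) \<partial>wm w) =
        (\<integral>\<^sup>+R. (\<integral>\<^sup>+x\<in>E R. ennreal (osc Q x powr p) \<partial>wm w) \<partial>count_space F)"
      unfolding V_def using F_count E(1) E_disj by (intro set_nn_integral_UN_disjoint) auto
    also have "\<dots> \<le> (\<integral>\<^sup>+R. k * emeasure (wm w) R +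
        ennreal (2 powr p * LpC CARD('n) p) * (ennreal (a R powr p) * emeasure (wm w) R) \<partial>count_space F)"
    proof (intro nn_integral_mono)
      fix R assume "R \<in> space (count_space F)"
      then have R: "R \<in> F" by simp
      note [measurable] = E(1)[OF R]
      have "(\<integral>\<^sup>+x\<in>E R. ennreal (osc Q x powr p) \<partial>wm w) \<le>
          (\<integral>\<^sup>+x. k * indicator (E R) x + ennreal (2 powr p) * (ennreal (osc R x powr p) * indicator (E R) x) \<partial>wm w)"
        using far[OF R] by (intro nn_integral_mono) (auto split: split_indicator)
      also have "\<dots> = (\<integral>\<^sup>+x. k * indicator (E R) x \<partial>wm w) +
          (\<integral>\<^sup>+x. ennreal (2 powr p) * (ennreal (osc R x powr p) * indicator (E R) x) \<partial>wm w)"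
        by (intro nn_integral_add) measurable
      also have "\<dots> = k * emeasure (wm w) (E R) +
          ennreal (2 powr p) * (\<integral>\<^sup>+x\<in>E R. ennreal (osc R x powr p) \<partial>wm w)"
        by (simp add: nn_integral_cmult nn_integral_cmult_indicator)
      also have "\<dots> \<le> k * emeasure (wm w) R + ennreal (2 powr p) * (ennreal (LpC CARD('n) p * a R powr p) * emeasure (wm w) R)"
        using E(2,4)[OF R] R F_sets by (intro add_mono mult_left_mono emeasure_mono) auto
      also have "\<dots> = k * emeasure (wm w) R +
          ennreal (2 powr p * LpC CARD('n) p) * (ennreal (a R powr p) * emeasure (wm w) R)"
        using LpC_pos by (simp add: ennreal_mult mult_ac)
      finally show "(\<integral>\<^sup>+x\<in>E R. ennreal (osc Q x powr p) \<partial>wm w) \<le> \<dots>" .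
    qed
    also have "\<dots> = k * (\<integral>\<^sup>+R. emeasure (wm w) R \<partial>count_space F) +
        ennreal (2 powr p * LpC CARD('n) p) * (\<integral>\<^sup>+R. ennreal (a R powr p) * emeasure (wm w) R \<partial>count_space F)"
      by (simp add: nn_integral_add nn_integral_cmult)
    also have "(\<integral>\<^sup>+R. emeasure (wm w) R \<partial>count_space F) = emeasure (wm w) (\<Union>F)"
      using F_count F_sets F_disj by (simp add: emeasure_Union_disjoint)
    also have "(\<integral>\<^sup>+R. ennreal (a R powr p) * emeasure (wm w) R \<partial>count_space F)
        \<le> ennreal (4 powr - p * a Q powr p) * emeasure (wm w) Q"
    proof -
      \<comment> \<open>Here the choice of \<open>L\<close> pays off: the root in the smallness
        condition cancels the dimension.\<close>
      have "(1 / L) powr (p / real CARD('n)) = (4 powr - real CARD('n)) powr (p / real CARD('n))"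
        by (simp add: L_def powr_minus powr_realpow divide_inverse)
      also have "\<dots> = 4 powr - p" by (simp add: powr_powr)
      finally show ?thesis
        using small_condition_countable[OF small w Suc.prems F_fam F_count L meas] by simp
    qed
    also have "k * emeasure (wm w) (Q - \<Union>F) + (k * emeasure (wm w) (\<Union>F) +
        ennreal (2 powr p * LpC CARD('n) p) * (ennreal (4 powr - p * a Q powr p) * emeasure (wm w) Q)) =
        k * (emeasure (wm w) (Q - \<Union>F) + emeasure (wm w) (\<Union>F)) +
        ennreal (2 powr p * LpC CARD('n) p * (4 powr - p * a Q powr p)) * emeasure (wm w) Q"
      using LpC_pos by (simp add: ennreal_mult distrib_left mult_ac add_ac)
    also have "emeasure (wm w) (Q - \<Union>F) + emeasure (wm w) (\<Union>F) = emeasure (wm w) Q"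
    proof -
      have "(Q - \<Union>F) \<union> \<Union>F = Q" using F_sub by blast
      then show ?thesis by (subst plus_emeasure) auto
    qed
    also have "k * emeasure (wm w) Q + ennreal (2 powr p * LpC CARD('n) p * (4 powr - p * a Q powr p)) * emeasure (wm w) Q
        = ennreal (2 powr p * K powr p + 2 powr p * LpC CARD('n) p * (4 powr - p * a Q powr p)) * emeasure (wm w) Q"
      unfolding k_def using LpC_pos by (simp add: distrib_right)
    also have "2 powr p * K powr p + 2 powr p * LpC CARD('n) p * (4 powr - p * a Q powr p) = LpC CARD('n) p * a Q powr p"
    proof -
      have "K powr p = (2 ^ CARD('n) * 4 ^ CARD('n)) powr p * a Q powr p"
        unfolding K_def L_def by (rule powr_mult)
      then have "2 powr p * K powr p + 2 powr p * LpC CARD('n) p * (4 powr - p * a Q powr p) =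
          (2 powr p * (2 ^ CARD('n) * 4 ^ CARD('n)) powr p + 2 powr p * (LpC CARD('n) p * 4 powr - p)) * a Q powr p"
        by (simp add: algebra_simps)
      then show ?thesis by (simp only: LpC_eq)
    qed
    finally show "(\<integral>\<^sup>+x\<in>?E. ennreal (osc Q x powr p) \<partial>wm w) \<le> ennreal (LpC CARD('n) p * a Q powr p) * emeasure (wm w) Q"
      by (simp add: add_left_mono add_right_mono mult_left_mono)
  qed
qed

text \<open>The exceptional sets of \<open>Lp_bound_off_exceptional_set\<close> have geometrically
  decreasing measure. By Borel--Cantelli almost every point of \<open>Q\<close> lies in
  \<open>E m\<close> for all large \<open>m\<close>, and Fatou's lemma transfers the uniform bound
  to \<open>Q\<close>.\<close>

lemma Lp_bound:
  assumes Q: "Q \<in> cubes"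
  shows "(\<integral>\<^sup>+x\<in>Q. ennreal (osc Q x powr p) \<partial>wm w) \<le> ennreal (LpC CARD('n) p * a Q powr p) * emeasure (wm w) Q"
proof -
  define L :: real where "L = 4 ^ CARD('n)"
  have L: "L > 1" by (simp add: L_def one_less_power)
  have "\<forall>m. \<exists>E. E \<in> sets lebesgue \<and> E \<subseteq> Q \<and>
      ennreal (L ^ m) * emeasure lebesgue (Q - E) \<le> emeasure lebesgue Q \<and>
      (\<integral>\<^sup>+x\<in>E. ennreal (osc Q x powr p) \<partial>wm w) \<le> ennreal (LpC CARD('n) p * a Q powr p) * emeasure (wm w) Q"
    (is "\<forall>m. \<exists>E. ?good m E")
  proof
    fix m
    from Lp_bound_off_exceptional_set[OF Q, of m, folded L_def] show "\<exists>E. ?good m E"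
      by (simp only: Bex_def)
  qed
  then have "\<exists>E. \<forall>m. ?good m (E m)" by (rule choice)
  then obtain E where "\<forall>m. ?good m (E m)" ..
  then have E: "\<And>m. E m \<in> sets lebesgue" "\<And>m. E m \<subseteq> Q"
    "\<And>m. ennreal (L ^ m) * emeasure lebesgue (Q - E m) \<le> emeasure lebesgue Q"
    "\<And>m. (\<integral>\<^sup>+x\<in>E m. ennreal (osc Q x powr p) \<partial>wm w) \<le> ennreal (LpC CARD('n) p * a Q powr p) * emeasure (wm w) Q"
    by blast+
  note [measurable] = E(1) cubes_lebesgue[OF Q]
  have fin: "emeasure lebesgue (Q - E m) < \<infinity>" for m
    using cubes_emeasure(4)[OF Q] by (rule le_less_trans[rotated]) (intro emeasure_mono; auto)
  have "summable (\<lambda>m. measure lebesgue (Q - E m))"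
  proof (rule summable_comparison_test')
    show "summable (\<lambda>m. measure lebesgue Q * (1 / L) ^ m)"
      using L by (intro summable_mult summable_geometric) auto
    fix m :: nat
    have "emeasure lebesgue (Q - E m) = ennreal (measure lebesgue (Q - E m))"
      by (rule emeasure_eq_ennreal_measure) (use fin[of m] in \<open>simp only: less_top infinity_ennreal_def\<close>)
    then have "ennreal (L ^ m) * ennreal (measure lebesgue (Q - E m)) \<le> ennreal (measure lebesgue Q)"
      using E(3)[of m] cubes_emeasure(1)[OF Q] by (simp only:)
    then have "ennreal (L ^ m * measure lebesgue (Q - E m)) \<le> ennreal (measure lebesgue Q)"
      using L by (simp add: ennreal_mult)
    then have "L ^ m * measure lebesgue (Q - E m) \<le> measure lebesgue Q"
      by (simp add: ennreal_le_iff)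
    then show "norm (measure lebesgue (Q - E m)) \<le> measure lebesgue Q * (1 / L) ^ m"
      using L by (simp add: field_simps)
  qed
  then have "AE x in lebesgue. eventually (\<lambda>m. x \<in> space lebesgue - (Q - E m)) sequentially"
    using fin by (intro borel_cantelli_AE1) auto
  then have "AE x in wm w. eventually (\<lambda>m. x \<in> space lebesgue - (Q - E m)) sequentially"
    by (rule AE_wm)
  then have "AE x in wm w. ennreal (osc Q x powr p) * indicator Q x \<le>
      liminf (\<lambda>m. ennreal (osc Q x powr p) * indicator (E m) x)"
  proof (rule AE_mp, intro AE_I2 impI)
    fix x assume "eventually (\<lambda>m. x \<in> space lebesgue - (Q - E m)) sequentially"
    then show "ennreal (osc Q x powr p) * indicator Q x \<le>
        liminf (\<lambda>m. ennreal (osc Q x powr p) * indicator (E m) x)"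
      by (intro Liminf_bounded, elim eventually_mono) (auto split: split_indicator)
  qed
  then have "(\<integral>\<^sup>+x\<in>Q. ennreal (osc Q x powr p) \<partial>wm w) \<le>
      (\<integral>\<^sup>+x. liminf (\<lambda>m. ennreal (osc Q x powr p) * indicator (E m) x) \<partial>wm w)"
    by (rule nn_integral_mono_AE)
  also have "\<dots> \<le> liminf (\<lambda>m. (\<integral>\<^sup>+x\<in>E m. ennreal (osc Q x powr p) \<partial>wm w))"
    by (rule nn_integral_liminf) measurable
  also have "\<dots> \<le> ennreal (LpC CARD('n) p * a Q powr p) * emeasure (wm w) Q"
    using E(4) by (intro Liminf_le) auto
  finally show ?thesis .
qed

end

subsection \<open>Weak-type inequality for Muckenhoupt weights\<close>

text \<open>Replaces Hoelder's inequality in the proof of the weak-type inequality for \<open>A\<^sub>p\<close> weights: with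
  \<open>u * v = \<bar>g\<bar>\<close>, the factor \<open>k\<close> is chosen such that the second term integrates to half of the
  left-hand side.\<close>

lemma mult_le_powr_sum:
  fixes u v k p :: real
  assumes "u > 0" "v > 0" "k > 0" "p > 1"
  shows "u * v \<le> (k * u) powr p + (v / k) powr (p / (p - 1))"
proof -
  define y where "y = (v / k) powr (1 / (p - 1))"
  have y: "y > 0" using assms by (simp add: y_def)
  have vy: "v / k = y powr (p - 1)" using assms by (simp add: y_def powr_powr)
  have uv: "u * v = (k * u) * y powr (p - 1)"
    using assms by (simp flip: vy)
  have yp: "(v / k) powr (p / (p - 1)) = y powr p"
    unfolding vy using assms by (simp add: powr_powr)
  have *: "z * z powr (p - 1) = z powr p" if "z > 0" for z :: real
    using that by (simp add: powr_diff)
  show ?thesis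
  proof (cases "k * u \<le> y")
    case True
    then have "u * v \<le> y * y powr (p - 1)"
      unfolding uv by (intro mult_right_mono) auto
    then show ?thesis using * y yp by (simp add: add_increasing)
  next
    case False
    then have "u * v \<le> (k * u) * (k * u) powr (p - 1)"
      unfolding uv using assms y by (intro mult_left_mono powr_mono2) auto
    then show ?thesis using *[of "k * u"] assms by (simp add: add_increasing2)
  qed
qed

lemma Ap_const_ge:
  assumes "R \<in> cubes"
  shows "p = 1 \<Longrightarrow> eavg R (\<lambda>x. ennreal (w x)) *
      esssup (restrict_space lebesgue R) (\<lambda>x. inverse (ennreal (w x))) \<le> Ap_const p w"
    and "p \<noteq> 1 \<Longrightarrow> eavg R (\<lambda>x. ennreal (w x)) *
      epowr (eavg R (\<lambda>x. epowr (ennreal (w x)) (1 - p / (p - 1)))) (p - 1) \<le> Ap_const p w"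
  using assms by (auto simp: Ap_const_def intro: SUP_upper)

lemma eavg_weight:
  fixes w :: "real ^ 'n \<Rightarrow> real"
  assumes "w \<in> borel_measurable lebesgue" "R \<in> cubes"
  shows "eavg R (\<lambda>x. ennreal (w x)) = emeasure (wm w) R / emeasure lebesgue R"
  using assms by (simp add: eavg_def emeasure_density cubes_lebesgue)

lemma epowr_measurable [measurable]: "(\<lambda>x. epowr x s) \<in> borel_measurable borel"
  unfolding epowr_def by measurable

lemma set_nn_integral_wm:
  fixes w :: "real ^ 'n \<Rightarrow> real"
  assumes [measurable]: "w \<in> borel_measurable lebesgue" "h \<in> borel_measurable lebesgue" "R \<in> sets lebesgue"
  shows "(\<integral>\<^sup>+x\<in>R. h x \<partial>wm w) = (\<integral>\<^sup>+x\<in>R. h x * ennreal (w x) \<partial>lebesgue)"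
  by (subst nn_integral_density) (auto intro!: nn_integral_cong simp: mult_ac)

text \<open>For \<open>p = 1\<close>, 1/w is bounded almost everywhere by its essential supremum.
  For \<open>p > 1\<close>, |g| is split between \<open>\<bar>g x\<bar> powr p * w x\<close> and the
  dual weight \<open>w powr (1 - q)\<close>, whose average is controlled by the A_p constant; giving
  half of the Lebesgue mass to the dual term produces the factor \<open>2 powr p\<close>. If
  \<open>R\<close> has w-measure 0 the claim is trivial; otherwise finiteness of the A_p constant
  makes the dual factor finite.\<close>

lemma Ap_weak_type:
  fixes w g :: "real ^ 'n \<Rightarrow> real"
  assumes w: "weight w" and R: "R \<in> cubes" and p: "p \<ge> 1" and Ap: "in_Ap p w"
    and g [measurable]: "g \<in> borel_measurable lebesgue" and s: "s > 0"
    and avg: "ennreal s * emeasure lebesgue R \<le> (\<integral>\<^sup>+x\<in>R. ennreal \<bar>g x\<bar> \<partial>lebesgue)"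
  shows "ennreal (s powr p) * emeasure (wm w) R \<le>
    ennreal (2 powr p) * Ap_const p w * (\<integral>\<^sup>+x\<in>R. ennreal (\<bar>g x\<bar> powr p) \<partial>wm w)"
proof -
  have wm [measurable]: "w \<in> borel_measurable lebesgue"
    using w by (auto simp: weight_def intro: locally_integrable_measurable)
  have w0: "w x \<ge> 0" for x using w by (simp add: weight_def)
  have Rs [measurable]: "R \<in> sets lebesgue" using R by (rule cubes_lebesgue)
  define m where "m = measure lebesgue R"
  have m: "emeasure lebesgue R = ennreal m" "m > 0" using cubes_emeasure[OF R] by (auto simp: m_def)
  obtain u where u: "emeasure (wm w) R = ennreal u" "u \<ge> 0"
    using emeasure_wm[OF w R order_refl Rs] wmeas_nonneg[OF w] by blast
  define X where "X = (\<integral>\<^sup>+x\<in>R. ennreal (\<bar>g x\<bar> powr p) \<partial>wm w)"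
  have X: "X = (\<integral>\<^sup>+x\<in>R. ennreal (\<bar>g x\<bar> powr p) * ennreal (w x) \<partial>lebesgue)"
    unfolding X_def by (rule set_nn_integral_wm) measurable
  have um: "eavg R (\<lambda>x. ennreal (w x)) = ennreal (u / m)"
    using u m by (simp add: eavg_weight[OF wm R] divide_ennreal)
  show ?thesis
  proof (cases "u = 0")
    case True
    then show ?thesis using u by simp
  next
    case u0: False
    with u have upos: "u > 0" by simp
    then have um0: "ennreal (u / m) \<noteq> 0" using m by simp
    show ?thesis
    proof (cases "p = 1")
      case True
      define e where "e = esssup (restrict_space lebesgue R) (\<lambda>x. inverse (ennreal (w x)))"
      have e: "ennreal (u / m) * e \<le> Ap_const p w"
        using Ap_const_ge(1)[OF R True, of w] by (simp add: e_def um)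
      have efin: "e \<noteq> \<infinity>"
      proof
        assume "e = \<infinity>"
        with e um0 have "Ap_const p w = \<infinity>" by (auto simp: ennreal_mult_top top_unique)
        then show False using Ap by (simp add: in_Ap_def)
      qed
      have "AE x in restrict_space lebesgue R. inverse (ennreal (w x)) \<le> e"
        unfolding e_def by (rule esssup_AE)
      then have "AE x in lebesgue. x \<in> R \<longrightarrow> inverse (ennreal (w x)) \<le> e"
        by (subst (asm) AE_restrict_space_iff) auto
      then have "AE x in lebesgue. ennreal \<bar>g x\<bar> * indicator R x \<le>
          e * (ennreal (\<bar>g x\<bar> powr p) * ennreal (w x) * indicator R x)"
      proof (rule AE_mp, intro AE_I2 impI)
        fix x assume ex: "x \<in> R \<longrightarrow> inverse (ennreal (w x)) \<le> e"
        show "ennreal \<bar>g x\<bar> * indicator R x \<le> e * (ennreal (\<bar>g x\<bar> powr p) * ennreal (w x) * indicator R x)"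
        proof (cases "x \<in> R")
          case True
          with ex have "inverse (ennreal (w x)) \<le> e" by simp
          with efin have "w x \<noteq> 0" by (auto simp: top_unique)
          then have "ennreal (w x) * inverse (ennreal (w x)) = 1"
            using w0[of x] by (simp add: inverse_ennreal flip: ennreal_mult)
          then have "ennreal \<bar>g x\<bar> = ennreal \<bar>g x\<bar> * ennreal (w x) * inverse (ennreal (w x))"
            by (simp add: mult.assoc)
          also have "\<dots> \<le> ennreal \<bar>g x\<bar> * ennreal (w x) * e"
            using \<open>inverse (ennreal (w x)) \<le> e\<close> by (intro mult_left_mono) auto
          finally show ?thesis using True \<open>p = 1\<close> by (simp add: mult_ac)
        qed simp
      qed
      then have "(\<integral>\<^sup>+x\<in>R. ennreal \<bar>g x\<bar> \<partial>lebesgue) \<le>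
          (\<integral>\<^sup>+x. e * (ennreal (\<bar>g x\<bar> powr p) * ennreal (w x) * indicator R x) \<partial>lebesgue)"
        by (rule nn_integral_mono_AE)
      also have "\<dots> = e * X"
        unfolding X by (rule nn_integral_cmult) measurable
      finally have sm: "ennreal (s * m) \<le> e * X"
        using avg s m by (simp add: ennreal_mult)
      have "ennreal (s powr p) * ennreal u = ennreal (u / m) * ennreal (s * m)"
        using m s u True by (simp flip: ennreal_mult)
      also have "\<dots> \<le> ennreal (u / m) * (e * X)"
        using sm by (rule mult_left_mono) simp
      also have "\<dots> \<le> Ap_const p w * X"
        using e by (simp add: mult_right_mono flip: mult.assoc)
      also have "\<dots> \<le> ennreal (2 powr p) * (Ap_const p w * X)"
        using True mult_right_mono[of 1 2 "Ap_const p w * X"] by simp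
      finally show ?thesis by (simp add: u X_def mult.assoc)
    next
      case False
      with p have p1: "p > 1" by simp
      define q where "q = p / (p - 1)"
      have q: "q > 1" "q * (p - 1) = p" "1 - q = - (1 / (p - 1))"
        using p1 by (auto simp: q_def field_simps)
      define h where "h x = epowr (ennreal (w x)) (1 - q)" for x
      have h [measurable]: "h \<in> borel_measurable lebesgue"
        unfolding h_def by measurable
      define Y where "Y = (\<integral>\<^sup>+x\<in>R. h x \<partial>lebesgue)"
      have e: "ennreal (u / m) * epowr (Y / ennreal m) (p - 1) \<le> Ap_const p w"
        using Ap_const_ge(2)[OF R False, of w, unfolded um] unfolding Y_def h_def q_def
        by (simp only: eavg_def m(1))
      have "Y \<noteq> \<infinity>"
      proof
        assume "Y = \<infinity>"
        then have "epowr (Y / ennreal m) (p - 1) = \<infinity>"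
          using m p1 by (simp add: epowr_def ennreal_top_divide)
        with e um0 have "Ap_const p w = \<infinity>" by (auto simp: ennreal_mult_top top_unique)
        then show False using Ap by (simp add: in_Ap_def)
      qed
      \<comment> \<open>The weight is finite everywhere, so its negative power vanishes nowhere and
        has positive integral over \<open>R\<close>.\<close>
      moreover have "Y \<noteq> 0"
      proof
        assume "Y = 0"
        then have "AE x in lebesgue. h x * indicator R x = 0"
          unfolding Y_def by (subst (asm) nn_integral_0_iff_AE) auto
        moreover have "h x \<noteq> 0" for x
          using q p1 w0[of x] by (auto simp: h_def epowr_def)
        ultimately have "AE x in lebesgue. x \<notin> R"
          by (elim eventually_mono) (auto split: split_indicator)
        then have "emeasure lebesgue R = 0"
          using AE_iff_null_sets[OF Rs] by auto
        then show False using m by simp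
      qed
      ultimately obtain y where y: "Y = ennreal y" "y > 0"
        by (cases Y) (auto simp: less_le)
      have ey: "ennreal ((u / m) * (y / m) powr (p - 1)) \<le> Ap_const p w"
      proof -
        have "epowr (Y / ennreal m) (p - 1) = ennreal ((y / m) powr (p - 1))"
          using y m p1 by (simp add: divide_ennreal epowr_def)
        moreover have "ennreal ((u / m) * (y / m) powr (p - 1)) = ennreal (u / m) * ennreal ((y / m) powr (p - 1))"
          using upos m by (intro ennreal_mult) auto
        ultimately show ?thesis using e by (simp only:)
      qed
      define k where "k = (2 * y / (s * m)) powr (1 / q)"
      have k: "k > 0" using y s m by (simp add: k_def)
      have kq: "k powr q = 2 * y / (s * m)" using y s m q by (simp add: k_def powr_powr)
      have kp: "k powr p = (2 * y / (s * m)) powr (p - 1)"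
      proof -
        have "p / q = p - 1" using p1 by (simp add: q_def)
        then show ?thesis by (simp add: k_def powr_powr)
      qed
      \<comment> \<open>At zeros of \<open>w\<close> the dual weight is infinite and the bound is
        trivial. Elsewhere the factors are |g| w^(1/p) and w^(-1/p), and -q/p = 1 - q makes the
        second term the dual weight.\<close>
      have pt: "ennreal \<bar>g x\<bar> \<le> ennreal (k powr p) * (ennreal (\<bar>g x\<bar> powr p) * ennreal (w x)) + ennreal (1 / k powr q) * h x" for x
      proof (cases "w x = 0")
        case True
        then have "h x = \<infinity>" using q p1 by (simp add: h_def epowr_def)
        moreover have "ennreal (1 / k powr q) \<noteq> 0" using k by simp
        ultimately show ?thesis by (simp add: ennreal_mult_top)
      next
        case False
        with w0[of x] have wp: "w x > 0" by simp
        show ?thesis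
        proof (cases "g x = 0")
          case False
          have "\<bar>g x\<bar> = (\<bar>g x\<bar> * w x powr (1 / p)) * w x powr (- (1 / p))"
            using wp by (simp add: powr_minus)
          also have "\<dots> \<le> (k * (\<bar>g x\<bar> * w x powr (1 / p))) powr p + (w x powr (- (1 / p)) / k) powr q"
            unfolding q_def using False wp k p1 by (intro mult_le_powr_sum) auto
          also have "(k * (\<bar>g x\<bar> * w x powr (1 / p))) powr p = k powr p * (\<bar>g x\<bar> powr p * w x)"
            using False wp k p1 by (simp add: powr_mult powr_powr)
          also have "(w x powr (- (1 / p)) / k) powr q = 1 / k powr q * w x powr (1 - q)"
          proof -
            have "- (1 / p) * q = 1 - q" using p1 by (simp add: q_def field_simps)
            then show ?thesis using wp k by (simp add: powr_divide powr_powr)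
          qed
          finally have "ennreal \<bar>g x\<bar> \<le> ennreal (k powr p * (\<bar>g x\<bar> powr p * w x) + 1 / k powr q * w x powr (1 - q))"
            by (rule ennreal_leI)
          also have "\<dots> = ennreal (k powr p) * (ennreal (\<bar>g x\<bar> powr p) * ennreal (w x)) + ennreal (1 / k powr q) * h x"
          proof -
            have "h x = ennreal (w x powr (1 - q))" using wp q p1 by (simp add: h_def epowr_def)
            moreover have "ennreal (1 / k powr q * w x powr (1 - q)) = ennreal (1 / k powr q) * ennreal (w x powr (1 - q))"
              using k by (intro ennreal_mult) auto
            moreover have "ennreal (k powr p * (\<bar>g x\<bar> powr p * w x)) =
                ennreal (k powr p) * (ennreal (\<bar>g x\<bar> powr p) * ennreal (w x))"
              using wp by (simp add: ennreal_mult)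
            moreover have "ennreal (k powr p * (\<bar>g x\<bar> powr p * w x) + 1 / k powr q * w x powr (1 - q)) =
                ennreal (k powr p * (\<bar>g x\<bar> powr p * w x)) + ennreal (1 / k powr q * w x powr (1 - q))"
              using wp k by (intro ennreal_plus) auto
            ultimately show ?thesis by (simp only:)
          qed
          finally show ?thesis .
        qed simp
      qed
      have "ennreal (s * m) \<le> (\<integral>\<^sup>+x\<in>R. ennreal \<bar>g x\<bar> \<partial>lebesgue)"
        using avg s m by (simp add: ennreal_mult)
      also have "\<dots> \<le> (\<integral>\<^sup>+x. ennreal (k powr p) * (ennreal (\<bar>g x\<bar> powr p) * ennreal (w x) * indicator R x) +
          ennreal (1 / k powr q) * (h x * indicator R x) \<partial>lebesgue)"
        using pt by (intro nn_integral_mono) (auto simp: mult.assoc split: split_indicator)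
      also have "\<dots> = ennreal (k powr p) * X + ennreal (1 / k powr q) * Y"
        unfolding X Y_def by (simp add: nn_integral_add nn_integral_cmult)
      also have "ennreal (1 / k powr q) * Y = ennreal (s * m / 2)"
        unfolding kq y(1) using y(2) s m by (simp flip: ennreal_mult)
      finally have "ennreal (s * m) \<le> ennreal (k powr p) * X + ennreal (s * m / 2)" .
      moreover have "ennreal (s * m) = ennreal (s * m / 2) + ennreal (s * m / 2)"
        using s m by (subst ennreal_plus[symmetric]) auto
      ultimately have "ennreal (s * m / 2) + ennreal (s * m / 2) \<le> ennreal (s * m / 2) + ennreal (k powr p) * X"
        by (simp only: add.commute)
      then have half: "ennreal (s * m / 2) \<le> ennreal (k powr p) * X"
        by (simp only: ennreal_add_left_cancel_le) simp
      \<comment> \<open>This factor turns \<open>s * m / 2\<close> into \<open>s powr p * u\<close>,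
        and its product with \<open>k powr p\<close> is \<open>2 powr p\<close> times the A_p
        product of \<open>R\<close>.\<close>
      define z where "z = 2 powr p * (u / m) * ((s * m / 2) powr (p - 1) / m powr (p - 1))"
      have z: "z \<ge> 0" using upos m by (simp add: z_def)
      have "ennreal (s powr p) * ennreal u = ennreal z * ennreal (s * m / 2)"
      proof -
        have "(s * m / 2) powr (p - 1) * (s * m / 2) = (s * m / 2) powr p"
          using s m by (simp add: powr_diff)
        also have "\<dots> = s powr p * m powr p / 2 powr p"
          using s m by (simp add: powr_mult powr_divide)
        finally have "z * (s * m / 2) = 2 powr p * (u / m) * (s powr p * m powr p / 2 powr p / m powr (p - 1))"
          unfolding z_def by (simp only: mult.assoc times_divide_eq_left)
        also have "\<dots> = s powr p * u"
          using m by (simp add: powr_diff)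
        finally show ?thesis using z s m u by (simp flip: ennreal_mult)
      qed
      also have "\<dots> \<le> ennreal z * (ennreal (k powr p) * X)"
        using half by (rule mult_left_mono) simp
      also have "\<dots> = ennreal (z * k powr p) * X"
        using z by (simp add: ennreal_mult mult.assoc)
      also have "z * k powr p = 2 powr p * ((u / m) * (y / m) powr (p - 1))"
      proof -
        have "(s * m / 2) powr (p - 1) / m powr (p - 1) * k powr p = (y / m) powr (p - 1)"
          unfolding kp using s m y by (simp flip: powr_mult powr_divide)
        then show ?thesis by (simp only: z_def mult.assoc)
      qed
      also have "ennreal \<dots> * X \<le> ennreal (2 powr p) * Ap_const p w * X"
        using ey upos m by (subst ennreal_mult) (auto intro!: mult_right_mono mult_left_mono)
      finally show ?thesis by (simp add: u X_def)
    qed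
  qed
qed

subsection \<open>Good-\<open>\<lambda>\<close> inequality\<close>

context poincare
begin

text \<open>The set where the dyadic maximal function of |f - f_Q|, localized to Q =
  \<open>cube c l\<close>, exceeds \<open>t\<close>.\<close>

definition level_set :: "real ^ 'n \<Rightarrow> real \<Rightarrow> real \<Rightarrow> (real ^ 'n) set" where
  "level_set c l t = \<Union>(cz c l (\<lambda>x. ennreal (osc (cube c l) x)) t)"

lemma ennreal_osc_measurable: "(\<lambda>x. ennreal (osc Q x)) \<in> borel_measurable lebesgue"
  by measurable

text \<open>On a stopping cube R inside \<open>P\<close> at the higher level, passing from f_Q to
  f_P costs at most 2^n t, so |f - f_P| still has average at least \<open>t\<close> on R. Then
  \<open>Ap_weak_type\<close> applies on each R, and summing leaves the integral over
  \<open>P\<close>, which \<open>Lp_bound\<close> estimates. Both terms on the right appear because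
  the two cases for \<open>a P\<close> are merged.\<close>

lemma level_set_inter_le:
  assumes l: "l > 0" and t: "t \<ge> a (cube c l)" and g: "g > 0" and r: "r > 0"
    and Ap: "in_Ap p w" "Ap_const p w = ennreal b" "b \<ge> 0"
    and P: "P \<in> cz c l (\<lambda>x. ennreal (osc (cube c l) x)) t"
  shows "emeasure (wm w) (level_set c l ((2 ^ CARD('n) + 1) * t) \<inter> P) \<le>
    ennreal (2 powr p * b * LpC CARD('n) p * g powr p) * emeasure (wm w) P +
    ennreal (1 / (g * t) powr r) * (ennreal (a P powr r) * emeasure (wm w) P)"
proof -
  define Q where "Q = cube c l"
  have Q: "Q \<in> cubes" using l by (simp add: Q_def cube_in_cubes)
  have aQ: "a Q > 0" using Q by (rule a_pos)
  have t0: "t > 0" using t aQ by (simp add: Q_def)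
  define J where "J = 2 ^ CARD('n) * t"
  have J: "J > 0" using t0 by (simp add: J_def)
  have M: "(2 ^ CARD('n) + 1) * t = J + t" by (simp add: J_def algebra_simps)
  define h where "h = (\<lambda>x. ennreal (osc Q x))"
  have h: "h \<in> borel_measurable lebesgue" unfolding h_def by (rule ennreal_osc_measurable)
  have P': "P \<in> cz c l h t" using P by (simp add: h_def Q_def)
  have Pc: "P \<in> cubes" using cz_cubes[OF l h P'] .
  have Ps [measurable]: "P \<in> sets lebesgue" using Pc by (rule cubes_lebesgue)
  have aP: "a P > 0" using Pc by (rule a_pos)
  have hQ: "(\<integral>\<^sup>+x\<in>cube c l. h x \<partial>lebesgue) \<le> ennreal t * emeasure lebesgue (cube c l)"
    unfolding h_def Q_def
    by (rule order_trans[OF nn_integral_osc_le[OF Q[unfolded Q_def]]], rule mult_right_mono[OF ennreal_leI[OF t]]) simp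
  have jump: "\<bar>avg P f - avg Q f\<bar> \<le> J"
    using avg_diff_le[OF Pc, of Q J] cz_le[OF l h P' hQ] J unfolding h_def J_def by simp
  define G where "G = {R \<in> cz c l h (J + t). R \<subseteq> P}"
  have G_sub: "G \<subseteq> cz c l h (J + t)" by (auto simp: G_def)
  have G: "countable G" "G \<subseteq> sets lebesgue" "disjoint G" "\<Union>G \<subseteq> P"
    using countable_subset[OF G_sub cz_countable[OF l h]] order_trans[OF G_sub cz_sets[OF l h]]
      pairwise_subset[OF cz_disjoint[OF l h] G_sub]
    by (auto simp: G_def)
  \<comment> \<open>A stopping cube at the higher level that meets \<open>P\<close> lies inside
    \<open>P\<close> by nesting.\<close>
  have cover: "level_set c l (J + t) \<inter> P \<subseteq> \<Union>G"
  proof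
    fix x assume x: "x \<in> level_set c l (J + t) \<inter> P"
    then obtain R where R: "R \<in> cz c l h (J + t)" "x \<in> R"
      unfolding level_set_def h_def Q_def by blast
    have "R \<subseteq> P"
      by (rule cz_nested[OF l h _ R(1) P']) (use x R J in auto)
    with R show "x \<in> \<Union>G" by (auto simp: G_def)
  qed
  have UG: "\<Union>G \<in> sets lebesgue" using G by (intro sets.countable_Union) auto
  show ?thesis
  proof (cases "a P \<le> g * t")
    case True
    define k where "k = 2 powr p * b"
    have k: "k \<ge> 0" using Ap by (simp add: k_def)
    have stopped: "ennreal (t powr p) * emeasure (wm w) R \<le> ennreal k * (\<integral>\<^sup>+x\<in>R. ennreal (osc P x powr p) \<partial>wm w)"
      if "R \<in> G" for R
    proof -
      have R: "R \<in> cz c l h (J + t)" using that by (simp add: G_def)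
      have Rc: "R \<in> cubes" using cz_cubes[OF l h R] .
      note [measurable] = cubes_lebesgue[OF Rc]
      define m where "m = measure lebesgue R"
      have m: "emeasure lebesgue R = ennreal m" "m > 0" using cubes_emeasure[OF Rc] by (auto simp: m_def)
      have "ennreal (J + t) * ennreal m \<le> (\<integral>\<^sup>+x\<in>R. h x \<partial>lebesgue)"
        using cz_gt[OF l h R] unfolding m by (rule less_imp_le)
      also have "\<dots> \<le> (\<integral>\<^sup>+x. ennreal J * indicator R x + ennreal (osc P x) * indicator R x \<partial>lebesgue)"
      proof (intro nn_integral_mono)
        fix x
        have "osc Q x \<le> J + osc P x" using osc_le_osc[of Q x P] jump by linarith
        then have "ennreal (osc Q x) \<le> ennreal (J + osc P x)" by (rule ennreal_leI)
        also have "\<dots> = ennreal J + ennreal (osc P x)" using J osc_nonneg by (intro ennreal_plus) auto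
        finally show "h x * indicator R x \<le> ennreal J * indicator R x + ennreal (osc P x) * indicator R x"
          by (auto simp: h_def split: split_indicator)
      qed
      also have "\<dots> = ennreal J * ennreal m + (\<integral>\<^sup>+x\<in>R. ennreal (osc P x) \<partial>lebesgue)"
        by (subst nn_integral_add) (auto simp: nn_integral_cmult_indicator m(1)[symmetric])
      finally have "ennreal (J * m) + ennreal (t * m) \<le> ennreal (J * m) + (\<integral>\<^sup>+x\<in>R. ennreal (osc P x) \<partial>lebesgue)"
        using J t0 m by (simp add: distrib_right ennreal_mult)
      then have "ennreal (t * m) \<le> (\<integral>\<^sup>+x\<in>R. ennreal (osc P x) \<partial>lebesgue)"
        by (simp only: ennreal_add_left_cancel_le) simp
      then have "ennreal t * emeasure lebesgue R \<le> (\<integral>\<^sup>+x\<in>R. ennreal \<bar>osc P x\<bar> \<partial>lebesgue)"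
        using m t0 osc_nonneg by (simp add: ennreal_mult)
      from Ap_weak_type[OF w Rc p Ap(1) osc_measurable t0 this]
      show ?thesis
        using Ap(2,3) osc_nonneg by (simp add: k_def ennreal_mult)
    qed
    have "ennreal (t powr p) * emeasure (wm w) (level_set c l (J + t) \<inter> P) \<le>
        ennreal (t powr p) * emeasure (wm w) (\<Union>G)"
      using cover UG by (intro mult_left_mono emeasure_mono) auto
    also have "\<dots> = (\<integral>\<^sup>+R. ennreal (t powr p) * emeasure (wm w) R \<partial>count_space G)"
      using G by (simp add: emeasure_Union_disjoint nn_integral_cmult)
    also have "\<dots> \<le> (\<integral>\<^sup>+R. ennreal k * (\<integral>\<^sup>+x\<in>R. ennreal (osc P x powr p) \<partial>wm w) \<partial>count_space G)"
      using stopped by (intro nn_integral_mono) auto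
    also have "\<dots> = ennreal k * (\<integral>\<^sup>+x\<in>\<Union>G. ennreal (osc P x powr p) \<partial>wm w)"
      using G by (subst set_nn_integral_Union_disjoint) (auto simp: nn_integral_cmult)
    also have "\<dots> \<le> ennreal k * (\<integral>\<^sup>+x\<in>P. ennreal (osc P x powr p) \<partial>wm w)"
      using G(4) by (intro mult_left_mono nn_integral_mono) (auto split: split_indicator)
    also have "\<dots> \<le> ennreal k * (ennreal (LpC CARD('n) p * a P powr p) * emeasure (wm w) P)"
      using Lp_bound[OF Pc] by (rule mult_left_mono) simp
    also have "\<dots> = ennreal (k * (LpC CARD('n) p * a P powr p)) * emeasure (wm w) P"
      using k LpC_pos by (simp add: ennreal_mult mult.assoc)
    also have "\<dots> \<le> ennreal (t powr p * (k * LpC CARD('n) p * g powr p)) * emeasure (wm w) P"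
    proof (intro mult_right_mono ennreal_leI)
      have "a P powr p \<le> (g * t) powr p" using True aP p by (intro powr_mono2) auto
      then have "k * (LpC CARD('n) p * a P powr p) \<le> k * (LpC CARD('n) p * (g * t) powr p)"
        using k LpC_pos by (intro mult_left_mono) auto
      then show "k * (LpC CARD('n) p * a P powr p) \<le> t powr p * (k * LpC CARD('n) p * g powr p)"
        by (simp add: powr_mult mult_ac)
    qed simp
    also have "\<dots> = ennreal (t powr p) * (ennreal (k * LpC CARD('n) p * g powr p) * emeasure (wm w) P)"
      using k LpC_pos by (simp add: ennreal_mult mult.assoc)
    finally have "emeasure (wm w) (level_set c l (J + t) \<inter> P) \<le> ennreal (k * LpC CARD('n) p * g powr p) * emeasure (wm w) P"
      by (rule ennreal_mult_left_le_cancel) (use t0 in simp)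
    then show ?thesis unfolding M k_def by (rule add_increasing2[rotated]) simp
  next
    case False
    \<comment> \<open>All of \<open>P\<close> is charged to the second term, in the manner of
      Chebyshev: \<open>(a P / (g * t)) powr r\<close> is at least 1.\<close>
    have "emeasure (wm w) (level_set c l (J + t) \<inter> P) \<le> 1 * emeasure (wm w) P"
      by (simp add: emeasure_mono)
    also have "\<dots> \<le> ennreal (1 / (g * t) powr r * a P powr r) * emeasure (wm w) P"
    proof (rule mult_right_mono)
      have "(g * t) powr r \<le> a P powr r" using False g t0 r by (intro powr_mono2) auto
      then have "1 \<le> 1 / (g * t) powr r * a P powr r" using g t0 by (simp add: field_simps)
      then show "1 \<le> ennreal (1 / (g * t) powr r * a P powr r)" by simp
    qed simp
    also have "\<dots> = ennreal (1 / (g * t) powr r) * (ennreal (a P powr r) * emeasure (wm w) P)"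
    proof -
      have "ennreal (1 / (g * t) powr r * a P powr r) = ennreal (1 / (g * t) powr r) * ennreal (a P powr r)"
        by (rule ennreal_mult) auto
      then show ?thesis by (simp only: mult.assoc)
    qed
    finally show ?thesis unfolding M by (rule add_increasing[rotated]) simp
  qed
qed

text \<open>The higher level set is contained in the lower one, hence is partitioned by the stopping
  cubes of height \<open>t\<close>. Summing \<open>level_set_inter_le\<close> over them recovers the
  lower level set in the first term and a D_r sum in the second.\<close>

lemma level_set_step:
  assumes l: "l > 0" and t: "t \<ge> a (cube c l)" and g: "g > 0" and r: "r > 0"
    and Ap: "in_Ap p w" "Ap_const p w = ennreal b" "b \<ge> 0"
    and D: "D_condition r w a A"
  shows "emeasure (wm w) (level_set c l ((2 ^ CARD('n) + 1) * t)) \<le>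
    ennreal (2 powr p * b * LpC CARD('n) p * g powr p) * emeasure (wm w) (level_set c l t) +
    ennreal (1 / (g * t) powr r * (A powr r * a (cube c l) powr r)) * emeasure (wm w) (cube c l)"
proof -
  define Q where "Q = cube c l"
  have Q: "Q \<in> cubes" using l by (simp add: Q_def cube_in_cubes)
  have aQ: "a Q > 0" using Q by (rule a_pos)
  have t0: "t > 0" using t aQ by (simp add: Q_def)
  define s where "s = (2 ^ CARD('n) + 1) * t"
  have ts: "t \<le> s" using t0 by (simp add: s_def algebra_simps)
  define h where "h = (\<lambda>x. ennreal (osc Q x))"
  have h: "h \<in> borel_measurable lebesgue" unfolding h_def by (rule ennreal_osc_measurable)
  have lev: "level_set c l u = \<Union>(cz c l h u)" for u
    by (simp add: level_set_def h_def Q_def)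
  define F where "F = cz c l h t"
  have F: "countable F" "F \<subseteq> sets lebesgue" "disjoint F" "subcube_family Q F"
    unfolding F_def Q_def using cz_countable[OF l h] cz_sets[OF l h] cz_disjoint[OF l h] cz_family[OF l h] by auto
  have ls [measurable]: "level_set c l u \<in> sets lebesgue" for u
    unfolding lev by (rule cz_Union_sets[OF l h])
  have "level_set c l s = (\<Union>P\<in>F. level_set c l s \<inter> P)"
    using cz_Union_antimono[OF ts, of c l h] unfolding lev F_def by blast
  then have "emeasure (wm w) (level_set c l s) = emeasure (wm w) (\<Union>P\<in>F. level_set c l s \<inter> P)"
    by (rule arg_cong)
  also have "\<dots> = (\<integral>\<^sup>+P. emeasure (wm w) (level_set c l s \<inter> P) \<partial>count_space F)"
    using F(1,2,3) ls by (intro emeasure_UN_countable) (auto simp: disjoint_family_on_def disjoint_def)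
  also have "\<dots> \<le> (\<integral>\<^sup>+P. ennreal (2 powr p * b * LpC CARD('n) p * g powr p) * emeasure (wm w) P +
      ennreal (1 / (g * t) powr r) * (ennreal (a P powr r) * emeasure (wm w) P) \<partial>count_space F)"
    unfolding s_def
  proof (intro nn_integral_mono)
    fix P assume "P \<in> space (count_space F)"
    then have "P \<in> cz c l (\<lambda>x. ennreal (osc (cube c l) x)) t" by (simp add: F_def h_def Q_def)
    from level_set_inter_le[OF l t g r Ap this]
    show "emeasure (wm w) (level_set c l ((2 ^ CARD('n) + 1) * t) \<inter> P) \<le>
      ennreal (2 powr p * b * LpC CARD('n) p * g powr p) * emeasure (wm w) P +
      ennreal (1 / (g * t) powr r) * (ennreal (a P powr r) * emeasure (wm w) P)" .
  qed
  also have "\<dots> = ennreal (2 powr p * b * LpC CARD('n) p * g powr p) * (\<integral>\<^sup>+P. emeasure (wm w) P \<partial>count_space F) +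
      ennreal (1 / (g * t) powr r) * (\<integral>\<^sup>+P. ennreal (a P powr r) * emeasure (wm w) P \<partial>count_space F)"
    by (simp add: nn_integral_add nn_integral_cmult)
  also have "(\<integral>\<^sup>+P. emeasure (wm w) P \<partial>count_space F) = emeasure (wm w) (level_set c l t)"
    unfolding lev F_def[symmetric] using F by (simp add: emeasure_Union_disjoint)
  also have "ennreal (2 powr p * b * LpC CARD('n) p * g powr p) * emeasure (wm w) (level_set c l t) +
      ennreal (1 / (g * t) powr r) * (\<integral>\<^sup>+P. ennreal (a P powr r) * emeasure (wm w) P \<partial>count_space F) \<le>
      ennreal (2 powr p * b * LpC CARD('n) p * g powr p) * emeasure (wm w) (level_set c l t) +
      ennreal (1 / (g * t) powr r) * (ennreal (A powr r * a Q powr r) * emeasure (wm w) Q)"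
    by (intro add_left_mono mult_left_mono D_condition_countable[OF D w Q F(4,1)]) simp
  also have "ennreal (1 / (g * t) powr r) * (ennreal (A powr r * a Q powr r) * emeasure (wm w) Q) =
      ennreal (1 / (g * t) powr r * (A powr r * a Q powr r)) * emeasure (wm w) Q"
  proof -
    have "ennreal (1 / (g * t) powr r * (A powr r * a Q powr r)) =
        ennreal (1 / (g * t) powr r) * ennreal (A powr r * a Q powr r)"
      by (rule ennreal_mult) auto
    then show ?thesis by (simp only: mult.assoc)
  qed
  finally show ?thesis by (simp only: s_def Q_def)
qed

end

text \<open>\<open>goodC n p r / 2\<close> absorbs the error term of the good-\<open>\<lambda>\<close> inequality; the summand
  \<open>2 powr r\<close> makes the bound trivial at the lowest level.\<close>

definition goodC :: "nat \<Rightarrow> real \<Rightarrow> real \<Rightarrow> real" where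
  "goodC n p r = 2 * (2 powr (p + 1) * LpC n p * (2 ^ n + 1) powr r) powr (r / p) * (2 ^ n + 1) powr r
     + 2 powr r"

lemma power_powr:
  fixes x :: real
  assumes "x > 0"
  shows "(x ^ k) powr r = (x powr r) ^ k"
  using assms by (simp add: powr_power powr_powr mult.commute flip: powr_realpow)

lemma goodC_ge: "goodC n p r \<ge> 2 powr r"
  by (simp add: goodC_def)

section \<open>Decay of the level sets and the distribution of the oscillation\<close>

context poincare
begin

text \<open>\<open>Ap_weak_type\<close> for the constant function 1 at height 1. The loss compared
  with the sharp lower bound 1 is compensated by the summand \<open>2 powr r\<close> of
  \<open>goodC\<close>.\<close>

lemma Ap_const_ge_2_powr:
  assumes "in_Ap p w" "Ap_const p w = ennreal b" "b \<ge> 0" "Q \<in> cubes" "emeasure (wm w) Q \<noteq> 0"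
  shows "b \<ge> 2 powr - p"
proof -
  have Qs [measurable]: "Q \<in> sets lebesgue" using assms(4) by (rule cubes_lebesgue)
  obtain u where u: "emeasure (wm w) Q = ennreal u" "u \<ge> 0"
    using emeasure_wm[OF w assms(4) order_refl Qs] wmeas_nonneg[OF w] by blast
  have "ennreal (1 powr p) * emeasure (wm w) Q \<le>
      ennreal (2 powr p) * Ap_const p w * (\<integral>\<^sup>+x\<in>Q. ennreal (\<bar>1\<bar> powr p) \<partial>wm w)"
    by (rule Ap_weak_type[OF w assms(4) p assms(1)]) auto
  then have "ennreal u \<le> ennreal (2 powr p * b * u)"
    using assms(2,3) u by (simp add: ennreal_mult)
  then have "u \<le> 2 powr p * b * u" using assms(3) u by (simp add: ennreal_le_iff)
  moreover have "u > 0" using u assms(5) by (cases "u = 0") auto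
  ultimately have "1 \<le> 2 powr p * b" by simp
  then show ?thesis by (simp add: powr_minus field_simps)
qed

text \<open>Test the D_r condition on the family consisting of \<open>Q\<close> alone.\<close>

lemma D_const_ge_1:
  assumes "D_condition r w a A" "r > 0" "Q \<in> cubes" "emeasure (wm w) Q \<noteq> 0"
  shows "A \<ge> 1"
proof (rule ccontr)
  assume A: "\<not> A \<ge> 1"
  have Qs [measurable]: "Q \<in> sets lebesgue" using assms(3) by (rule cubes_lebesgue)
  obtain u where u: "emeasure (wm w) Q = ennreal u" "u \<ge> 0"
    using emeasure_wm[OF w assms(3) order_refl Qs] wmeas_nonneg[OF w] by blast
  have upos: "u > 0" using u assms(4) by (cases "u = 0") auto
  have aQ: "a Q powr r > 0" using a_pos[OF assms(3)] by simp
  have "A \<ge> 0" using assms(1) by (simp add: D_condition_def)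
  have "subcube_family Q {Q}" using assms(3) by (auto simp: subcube_family_def)
  from D_condition_countable[OF assms(1) w assms(3) this]
  have "ennreal (a Q powr r * u) \<le> ennreal (A powr r * a Q powr r * u)"
    using u by (simp add: nn_integral_count_space_finite ennreal_mult)
  then have "a Q powr r * u \<le> A powr r * a Q powr r * u"
    using u by (simp add: ennreal_le_iff)
  then have "1 * (a Q powr r * u) \<le> A powr r * (a Q powr r * u)" by (simp add: mult.assoc)
  then have "1 \<le> A powr r"
    using upos aQ by (subst (asm) mult_le_cancel_right_pos) auto
  moreover have "A powr r < 1 powr r" using A \<open>A \<ge> 0\<close> assms(2) by (intro powr_less_mono2) auto
  ultimately show False by simp
qed

lemma one_le_goodC_mult:
  assumes "Q \<in> cubes" "r > 0" "in_Ap p w" "Ap_const p w = ennreal b" "b > 0"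
    and "D_condition r w a A" "emeasure (wm w) Q \<noteq> 0"
  shows "1 \<le> goodC CARD('n) p r * (A powr r * b powr (r / p))"
proof -
  have "1 powr r \<le> A powr r"
    using D_const_ge_1[OF assms(6,2,1,7)] assms(2) by (intro powr_mono2) auto
  moreover have "(2 powr - p) powr (r / p) \<le> b powr (r / p)"
    using Ap_const_ge_2_powr[OF assms(3,4) _ assms(1,7)] assms(2,5) p by (intro powr_mono2) auto
  moreover have "(2 powr - p) powr (r / p) = 2 powr - r"
    using p by (simp add: powr_powr)
  ultimately have "1 * 2 powr - r \<le> A powr r * b powr (r / p)"
    by (intro mult_mono) auto
  then have "2 powr r * 2 powr - r \<le> goodC CARD('n) p r * (A powr r * b powr (r / p))"
    using goodC_ge[of r "CARD('n)" p] by (intro mult_mono) (auto intro: order_trans[rotated])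
  then show ?thesis by (simp flip: powr_add)
qed

text \<open>Along the levels M^k a(Q), the good-lambda inequality with main coefficient half of
  M^(-r) preserves the decay M^(-kr): each of its two terms uses at most half of the bound for the
  next level.\<close>

lemma level_set_decay:
  assumes l: "l > 0" and r: "r > 0"
    and Ap: "in_Ap p w" "Ap_const p w = ennreal b" "b > 0"
    and D: "D_condition r w a A"
    and W: "emeasure (wm w) (cube c l) \<noteq> 0"
  shows "emeasure (wm w) (level_set c l ((2 ^ CARD('n) + 1) ^ k * a (cube c l))) \<le>
    ennreal (goodC CARD('n) p r * (A powr r * b powr (r / p)) / ((2 ^ CARD('n) + 1) powr r) ^ k)
      * emeasure (wm w) (cube c l)"
proof (induction k)
  define Q where "Q = cube c l"
  have Q: "Q \<in> cubes" using l by (simp add: Q_def cube_in_cubes)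
  define S where "S = A powr r * b powr (r / p)"
  define m where "m = (2 ^ CARD('n) + 1 :: real)"
  have m: "m > 1" by (simp add: m_def)
  define C where "C = goodC CARD('n) p r"
  have C: "C \<ge> 2 powr r" unfolding C_def by (rule goodC_ge)
  have C0: "C > 0" using C by (rule less_le_trans[rotated]) simp
  {
    case 0
    have "1 \<le> C * S"
      unfolding C_def S_def using one_le_goodC_mult[OF Q r Ap D] W by (simp add: Q_def)
    then have "1 * emeasure (wm w) Q \<le> ennreal (C * S) * emeasure (wm w) Q"
      by (intro mult_right_mono) auto
    moreover have "level_set c l u \<subseteq> Q" for u
      unfolding level_set_def Q_def using cz_subset[OF l ennreal_osc_measurable] by blast
    then have "emeasure (wm w) (level_set c l (a Q)) \<le> emeasure (wm w) Q"
      using cubes_lebesgue[OF Q] by (intro emeasure_mono) auto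
    ultimately show ?case by (simp add: C_def S_def Q_def)
  next
    case (Suc k)
    \<comment> \<open>With \<open>g powr p = 1 / (v * b)\<close> the main coefficient becomes
      \<open>1 / (2 * m powr r)\<close>. Since \<open>g\<close> is proportional to
      \<open>b powr (- 1 / p)\<close>, the error term, which carries \<open>g powr - r\<close>,
      acquires the factor \<open>b powr (r / p)\<close>.\<close>
    define v where "v = 2 powr (p + 1) * LpC CARD('n) p * m powr r"
    have v: "v > 0" using LpC_pos m by (simp add: v_def)
    define g where "g = (1 / (v * b)) powr (1 / p)"
    have g: "g > 0" using v Ap by (simp add: g_def)
    have "g powr p = 1 / (v * b)" using p v Ap by (simp add: g_def powr_powr)
    then have eta: "2 powr p * b * LpC CARD('n) p * g powr p = 1 / (2 * m powr r)"
      using v Ap LpC_pos m by (simp add: v_def powr_add)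
    have gr: "g powr r = 1 / (v powr (r / p) * b powr (r / p))"
      using v Ap by (simp add: g_def powr_powr powr_divide powr_mult)
    define t where "t = m ^ k * a Q"
    have aQ: "a Q > 0" using Q by (rule a_pos)
    have t: "t \<ge> a Q" using m aQ by (simp add: t_def)
    define N where "N = (m powr r) ^ k"
    have N: "N > 0" using m by (simp add: N_def)
    have tr: "t powr r = N * a Q powr r"
      using m by (simp add: t_def N_def powr_mult power_powr)
    have err: "1 / (g * t) powr r * (A powr r * a Q powr r) = v powr (r / p) * S / N"
      using aQ N v Ap by (simp add: powr_mult gr tr S_def field_simps)
    have "emeasure (wm w) (level_set c l (m * t)) \<le>
      ennreal (1 / (2 * m powr r)) * emeasure (wm w) (level_set c l t) + ennreal (v powr (r / p) * S / N) * emeasure (wm w) Q"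
      using level_set_step[OF l t[unfolded Q_def] g r Ap(1,2) less_imp_le[OF Ap(3)] D]
      unfolding eta Q_def[symmetric] err m_def[symmetric] .
    also have "\<dots> \<le> ennreal (1 / (2 * m powr r)) * (ennreal (C * S / N) * emeasure (wm w) Q) + ennreal (v powr (r / p) * S / N) * emeasure (wm w) Q"
      using Suc.IH unfolding t_def N_def C_def S_def Q_def m_def
      by (intro add_right_mono mult_left_mono) auto
    also have "\<dots> = ennreal (1 / (2 * m powr r) * (C * S / N) + v powr (r / p) * S / N) * emeasure (wm w) Q"
    proof -
      have S0: "S \<ge> 0" by (simp add: S_def)
      have "ennreal (1 / (2 * m powr r)) * ennreal (C * S / N) = ennreal (1 / (2 * m powr r) * (C * S / N))"
        using C0 S0 N by (intro ennreal_mult[symmetric]) auto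
      moreover have "ennreal (1 / (2 * m powr r) * (C * S / N)) + ennreal (v powr (r / p) * S / N) =
          ennreal (1 / (2 * m powr r) * (C * S / N) + v powr (r / p) * S / N)"
        using C0 S0 N by (intro ennreal_plus[symmetric]) auto
      ultimately show ?thesis by (simp only: mult.assoc[symmetric] distrib_right[symmetric])
    qed
    also have "\<dots> \<le> ennreal (C * S / (m powr r * N)) * emeasure (wm w) Q"
    proof (intro mult_right_mono ennreal_leI)
      \<comment> \<open>The first summand of \<open>goodC\<close> is exactly the left-hand side, so
        the error term fits into the remaining half.\<close>
      have "2 * v powr (r / p) * m powr r \<le> C"
        by (simp add: C_def goodC_def v_def m_def)
      then have "v powr (r / p) \<le> C / (2 * m powr r)" using m by (simp add: field_simps)
      then have "v powr (r / p) * (S / N) \<le> C / (2 * m powr r) * (S / N)"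
        using N by (intro mult_right_mono) (auto simp: S_def)
      moreover have "1 / (2 * m powr r) * (C * S / N) = C / (2 * m powr r) * (S / N)" by simp
      moreover have "v powr (r / p) * S / N = v powr (r / p) * (S / N)" by simp
      moreover have "C * S / (m powr r * N) = 2 * (C / (2 * m powr r) * (S / N))" by simp
      ultimately show "1 / (2 * m powr r) * (C * S / N) + v powr (r / p) * S / N \<le> C * S / (m powr r * N)"
        by linarith
    qed simp
    finally show ?case
      by (simp add: t_def N_def C_def S_def Q_def m_def mult.assoc)
  }
qed

text \<open>A general height lies between two consecutive levels M^k a(Q) and M^(k+1) a(Q), so
  passing from discrete to arbitrary heights costs one factor M^r. Outside the level set the
  oscillation is almost everywhere at most the level, by \<open>cz_AE_le\<close>.\<close>

lemma weak_type_bound: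
  assumes Q: "Q \<in> cubes" and r: "r > 0"
    and Ap: "in_Ap p w" "Ap_const p w = ennreal b" "b > 0"
    and D: "D_condition r w a A"
    and W: "emeasure (wm w) Q \<noteq> 0"
    and t: "t > 0"
  shows "ennreal (t powr r) * emeasure (wm w) {x\<in>Q. osc Q x > t} \<le>
    ennreal (goodC CARD('n) p r * (2 ^ CARD('n) + 1) powr r * (A powr r * b powr (r / p)) * a Q powr r)
      * emeasure (wm w) Q"
proof -
  obtain c l where l: "l > 0" and Qc: "Q = cube c l" using Q by (rule cubesE)
  have Qs [measurable]: "Q \<in> sets lebesgue" using Q by (rule cubes_lebesgue)
  define m where "m = (2 ^ CARD('n) + 1 :: real)"
  have m: "m > 1" by (simp add: m_def)
  have aQ: "a Q > 0" using Q by (rule a_pos)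
  define B where "B = goodC CARD('n) p r * (A powr r * b powr (r / p))"
  have decay: "emeasure (wm w) (level_set c l (m ^ k * a Q)) \<le> ennreal (B / (m powr r) ^ k) * emeasure (wm w) Q" for k
    using level_set_decay[OF l r Ap D W[unfolded Qc]] by (simp add: B_def m_def Qc)
  have B: "B \<ge> 0"
    unfolding B_def using goodC_ge[of r "CARD('n)" p] by (intro mult_nonneg_nonneg) (auto intro: order_trans[rotated])
  \<comment> \<open>Below the lowest level, \<open>k = 0\<close> is used with the trivial bound by
    the measure of \<open>Q\<close>, which \<open>one_le_goodC_mult\<close> justifies.\<close>
  define k where "k = (if t < a Q then 0 else LEAST k. t < m ^ Suc k * a Q)"
  have k: "t \<le> m ^ Suc k * a Q" "t < a Q \<or> m ^ k * a Q \<le> t"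
  proof -
    have "m ^ k * a Q \<le> t \<and> t \<le> m ^ Suc k * a Q" if ta: "a Q \<le> t"
    proof -
      obtain j where "t / a Q < m ^ j" using real_arch_pow[OF m] by blast
      also have "m ^ j \<le> m ^ Suc j" using m by simp
      finally have ex: "t < m ^ Suc j * a Q" using aQ by (simp add: field_simps)
      have keq: "k = (LEAST k. t < m ^ Suc k * a Q)" using ta by (simp add: k_def)
      have "t < m ^ Suc k * a Q" unfolding keq by (rule LeastI[of _ j]) (rule ex)
      moreover have "m ^ k * a Q \<le> t"
      proof (cases k)
        case 0
        then show ?thesis using ta by simp
      next
        case (Suc i)
        then have "\<not> t < m ^ Suc i * a Q" using not_less_Least[of i "\<lambda>k. t < m ^ Suc k * a Q"] keq by simp
        then show ?thesis using Suc by simp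
      qed
      ultimately show ?thesis by simp
    qed
    moreover have "t \<le> m ^ Suc k * a Q" if "t < a Q"
    proof -
      have "1 * a Q \<le> m ^ Suc k * a Q" using m aQ by (intro mult_right_mono one_le_power) auto
      then show ?thesis using that by simp
    qed
    ultimately show "t \<le> m ^ Suc k * a Q" "t < a Q \<or> m ^ k * a Q \<le> t" by force+
  qed
  have ls: "level_set c l u \<in> sets lebesgue" for u
    unfolding level_set_def by (rule cz_Union_sets[OF l ennreal_osc_measurable])
  have "emeasure (wm w) {x\<in>Q. osc Q x > t} \<le> ennreal (B / (m powr r) ^ k) * emeasure (wm w) Q"
  proof (cases "t < a Q")
    case True
    then have "k = 0" by (simp add: k_def)
    have "1 \<le> B"
      unfolding B_def by (rule one_le_goodC_mult[OF Q r Ap D W])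
    have "emeasure (wm w) {x\<in>Q. osc Q x > t} \<le> 1 * emeasure (wm w) Q"
      by (simp, intro emeasure_mono) auto
    also have "\<dots> \<le> ennreal B * emeasure (wm w) Q"
      using \<open>1 \<le> B\<close> by (intro mult_right_mono) auto
    finally show ?thesis using \<open>k = 0\<close> by simp
  next
    case False
    with k have kt: "m ^ k * a Q \<le> t" by simp
    have "AE x in lebesgue. x \<in> Q - level_set c l (m ^ k * a Q) \<longrightarrow> ennreal (osc Q x) \<le> ennreal (m ^ k * a Q)"
      unfolding level_set_def Qc using aQ m
      by (intro cz_AE_le[OF l ennreal_osc_measurable]) (simp add: Qc)
    then have "AE x in wm w. x \<in> Q - level_set c l (m ^ k * a Q) \<longrightarrow> ennreal (osc Q x) \<le> ennreal (m ^ k * a Q)"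
      by (rule AE_wm)
    then have "AE x in wm w. x \<in> {x\<in>Q. osc Q x > t} \<longrightarrow> x \<in> level_set c l (m ^ k * a Q)"
    proof (rule eventually_mono)
      fix x assume "x \<in> Q - level_set c l (m ^ k * a Q) \<longrightarrow> ennreal (osc Q x) \<le> ennreal (m ^ k * a Q)"
      then show "x \<in> {x\<in>Q. osc Q x > t} \<longrightarrow> x \<in> level_set c l (m ^ k * a Q)"
        using kt m aQ by (auto simp: ennreal_le_iff)
    qed
    then have "emeasure (wm w) {x\<in>Q. osc Q x > t} \<le> emeasure (wm w) (level_set c l (m ^ k * a Q))"
      using ls by (intro emeasure_mono_AE) auto
    then show ?thesis using decay by (rule order_trans)
  qed
  then have "ennreal (t powr r) * emeasure (wm w) {x\<in>Q. osc Q x > t} \<le>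
      ennreal (t powr r) * (ennreal (B / (m powr r) ^ k) * emeasure (wm w) Q)"
    by (rule mult_left_mono) simp
  also have "\<dots> = ennreal (t powr r * (B / (m powr r) ^ k)) * emeasure (wm w) Q"
    using B m by (subst ennreal_mult) (auto simp: mult.assoc)
  also have "\<dots> \<le> ennreal (B * m powr r * a Q powr r) * emeasure (wm w) Q"
  proof (intro mult_right_mono ennreal_leI)
    have "t powr r \<le> (m ^ Suc k * a Q) powr r" using k t r by (intro powr_mono2) auto
    also have "\<dots> = m powr r * (m powr r) ^ k * a Q powr r"
      using power_powr[of m "Suc k" r] m by (simp add: powr_mult)
    finally have "t powr r * (B / (m powr r) ^ k) \<le> m powr r * (m powr r) ^ k * a Q powr r * (B / (m powr r) ^ k)"
      using B m by (intro mult_right_mono) auto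
    also have "\<dots> = B * m powr r * a Q powr r" using m by simp
    finally show "t powr r * (B / (m powr r) ^ k) \<le> B * m powr r * a Q powr r" .
  qed simp
  finally show ?thesis by (simp add: B_def m_def mult_ac)
qed

end

section \<open>From the distribution estimate to the normalized weak norm\<close>

theorem theorem1p14:
  fixes p r :: real
  assumes "CARD('n::finite) \<ge> 2" and "1 \<le> p" and "p < r"
  shows "\<exists>c::real. c > 0 \<and>
    (\<forall>(w :: real ^ 'n \<Rightarrow> real) (a :: (real ^ 'n) set \<Rightarrow> real) (f :: real ^ 'n \<Rightarrow> real) (A :: real).
      weight w \<longrightarrow>
      (\<forall>Q\<in>cubes. a Q > 0) \<longrightarrow>
      small_condition p w a \<longrightarrow>
      D_condition r w a A \<longrightarrow>
      locally_integrable f \<longrightarrow>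
      (\<forall>Q\<in>cubes. avg Q (\<lambda>x. \<bar>f x - avg Q f\<bar>) \<le> a Q) \<longrightarrow>
      in_Ap p w \<longrightarrow>
      (\<forall>Q\<in>cubes. weak_norm r w Q (\<lambda>x. f x - avg Q f)
         \<le> ennreal c * ennreal A * epowr (Ap_const p w) (1 / p) * ennreal (a Q)))"
proof -
  \<comment> \<open>The constant of \<open>weak_type_bound\<close> without its factors in
    \<open>A\<close>, \<open>b\<close> and \<open>a Q\<close>; its r-th root is the witness for
    \<open>c\<close>.\<close>
  define K where "K = goodC CARD('n) p r * (2 ^ CARD('n) + 1) powr r"
  have K: "K > 0"
    unfolding K_def using goodC_ge[of r "CARD('n)" p]
    by (intro mult_pos_pos) (auto intro: less_le_trans[rotated] simp: add_nonneg_eq_0_iff)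
  have r: "r > 0" using assms by simp
  have main: "weak_norm r w Q (\<lambda>x. f x - avg Q f)
         \<le> ennreal (K powr (1 / r)) * ennreal A * epowr (Ap_const p w) (1 / p) * ennreal (a Q)"
    if h: "weight w" "\<forall>Q\<in>cubes. a Q > 0" "small_condition p w a" "D_condition r w a A"
      "locally_integrable f" "\<forall>Q\<in>cubes. avg Q (\<lambda>x. \<bar>f x - avg Q f\<bar>) \<le> a Q" "in_Ap p w" and Q: "Q \<in> cubes"
    for w f :: "real ^ 'n \<Rightarrow> real" and a A Q
  proof -
    interpret poincare w f a p
      by unfold_locales (use h assms in auto)
    have A: "A \<ge> 0" using h(4) by (simp add: D_condition_def)
    have aQ: "a Q > 0" using Q by (rule a_pos)
    have Qs [measurable]: "Q \<in> sets lebesgue" using Q by (rule cubes_lebesgue)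
    define u where "u = wmeas w Q"
    have u: "u \<ge> 0" "emeasure (wm w) Q = ennreal u"
      using wmeas_nonneg[OF w] emeasure_wm[OF w Q order_refl Qs] by (auto simp: u_def)
    obtain b where b: "Ap_const p w = ennreal b" "b \<ge> 0"
      using h(7) by (cases "Ap_const p w") (auto simp: in_Ap_def)
    show ?thesis
    proof (cases "u = 0")
      case True
      \<comment> \<open>Division by zero gives 0, so the weak norm of a cube of w-measure 0 is
        0.\<close>
      then show ?thesis using r by (simp add: weak_norm_def u_def)
    next
      case False
      with u have upos: "u > 0" by simp
      then have W: "emeasure (wm w) Q \<noteq> 0" using u by simp
      have "b \<ge> 2 powr - p" by (rule Ap_const_ge_2_powr[OF h(7) b Q W])
      then have bpos: "b > 0" by (rule less_le_trans[rotated]) simp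
      have rhs: "ennreal (K powr (1 / r)) * ennreal A * epowr (Ap_const p w) (1 / p) * ennreal (a Q) =
          ennreal (K powr (1 / r) * A * b powr (1 / p) * a Q)"
      proof -
        have "epowr (Ap_const p w) (1 / p) = ennreal (b powr (1 / p))"
          using b bpos p by (simp add: epowr_def)
        then show ?thesis using A aQ by (simp add: ennreal_mult)
      qed
      show ?thesis unfolding rhs weak_norm_def
      proof (rule SUP_least)
        fix t :: real assume "t \<in> {0<..}"
        then have t: "t > 0" by simp
        define v where "v = wmeas w {x\<in>Q. \<bar>f x - avg Q f\<bar> > t}"
        have v: "v \<ge> 0" using wmeas_nonneg[OF w] by (simp add: v_def)
        have set: "{x\<in>Q. \<bar>f x - avg Q f\<bar> > t} = {x\<in>Q. osc Q x > t}" by (simp add: osc_def)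
        have "{x\<in>Q. osc Q x > t} \<in> sets lebesgue" by measurable
        then have "emeasure (wm w) {x\<in>Q. osc Q x > t} = ennreal v"
          unfolding v_def set by (intro emeasure_wm[OF w Q]) auto
        with weak_type_bound[OF Q r h(7) b(1) bpos h(4) W t, folded K_def]
        have "ennreal (t powr r * v) \<le> ennreal (K * (A powr r * b powr (r / p)) * a Q powr r * u)"
          using u v K by (simp add: ennreal_mult)
        then have "t powr r * v \<le> K * (A powr r * b powr (r / p)) * a Q powr r * u"
          using u K by (subst (asm) ennreal_le_iff) auto
        then have "t powr r * (v / u) \<le> K * (A powr r * b powr (r / p)) * a Q powr r"
          using upos by (simp add: field_simps)
        then have "(t powr r * (v / u)) powr (1 / r) \<le> (K * (A powr r * b powr (r / p)) * a Q powr r) powr (1 / r)"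
          using r v u by (intro powr_mono2) auto
        also have "\<dots> = K powr (1 / r) * A * b powr (1 / p) * a Q"
          using r A aQ by (simp add: powr_mult powr_powr)
        also have "(t powr r * (v / u)) powr (1 / r) = t * (v / u) powr (1 / r)"
        proof -
          have "(t powr r) powr (1 / r) = t" using r t by (simp add: powr_powr)
          then show ?thesis by (simp only: powr_mult)
        qed
        finally show "ennreal (t * (wmeas w {x\<in>Q. \<bar>f x - avg Q f\<bar> > t} / wmeas w Q) powr (1 / r)) \<le>
            ennreal (K powr (1 / r) * A * b powr (1 / p) * a Q)"
          unfolding v_def u_def by (rule ennreal_leI)
      qed
    qed
  qed
  show ?thesis
    by (rule exI[of _ "K powr (1 / r)"]) (use K main in auto)
qed

end
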